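(* Let $F$ be a distribution on $\mathbb{R}$ and let $W \sim F$. Assume that $\mathrm{Var}(W) < \infty$, and that there exist an integer $\ell \geq 2$ and a Borel set $A \subseteq \mathbb{R}$ such that $\mathbb{P}(W \in A) = \ell^{-1}$ and $\mathbb{E}[W \mid W \in A] \neq \mathbb{E}[W \mid W \in A^c]$. Fix such $\ell$ and $A$, and let $\mu$ and $\sigma^2$ denote the mean and variance of $F$. Let $U$ be a random variable with the conditional law of $W$ given $\{W \in A^c\}$, and $V$ a random variable with the conditional law of $W$ given $\{W \in A\}$; set $\mu_U = \mathbb{E}[U]$, $\mu_V = \mathbb{E}[V]$. For each integer $m \geq 2$, let $n = \binom{m}{2}$ and construct on a common probability space: - $\mathbf{M}_1, \ldots, \mathbf{M}_m$ i.i.d. with distribution $\mathrm{Multinomial}(1; (\ell^{-1}, \ldots, \ell^{-1}))$ (i.e., each $\mathbf{M}_j$ falls uniformly into one of $\ell$ categories); - for $1 \leq i < j \leq m$, $D_{i,j} = 1$ if $\mathbf{M}_i = \mathbf{M}_j$ and $D_{i,j} = 0$ otherwise; enumerate these $n$ variables as $D_1, \ldots, D_n$ via $D_{k(i,j)} := D_{i,j}$ with $k(i,j) = [i(2m-1) - i^2]/2 + j - m$; - $U_1, \ldots, U_n$ i.i.d. copies of $U$ and $V_1, \ldots, V_n$ i.i.d. copies of $V$, with $(\mathbf{M}_j)_j$, $(U_k)_k$, $(V_k)_k$ mutually independent; - for $k = 1, \ldots, n$, $X_k = U_k$ if $D_k = 0$ and $X_k = V_k$ if $D_k = 1$. Then: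 (a) $X_1, \ldots, X_n$ are pairwise independent; (b) as $m \to \infty$ (hence $n \to \infty$), the standardized sample mean $S_n := \big(\sum_{k=1}^n X_k - \mu n\big)/(\sigma\sqrt{n})$ converges in distribution to $$S := \sqrt{1 - r^2}\, Z + r\, \chi,$$ where $Z \sim N(0,1)$, $\chi$ is independent of $Z$ and distributed as $(\Gamma - (\ell-1))/\sqrt{2(\ell-1)}$ with $\Gamma \sim \chi^2_{\ell-1}$, and $$r := \frac{\sqrt{\ell^{-1}(1 - \ell^{-1})}\,(\mu_V - \mu_U)}{\sigma}.$$
   Context: $\chi^2_{\ell-1}$ denotes the chi-squared distribution with $\ell-1$ degrees of freedom. Each $X_k$ constructed in this way has marginal distribution $F$. *)

theory Defs
  imports "HOL-Probability.Probability"
begin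

text \<open>Enumeration of pairs i<j (1-based) as k(i,j) = [i(2m-1) - i^2]/2 + j - m.\<close>
definition kidx :: "nat \<Rightarrow> nat \<Rightarrow> nat \<Rightarrow> nat" where
  "kidx m i j = (i * (2 * m - 1) - i ^ 2) div 2 + j - m"

definition chi2_density :: "nat \<Rightarrow> real \<Rightarrow> real" where
  "chi2_density k x =
     (if x > 0 then x powr (real k / 2 - 1) * exp (- x / 2) / (2 powr (real k / 2) * Gamma (real k / 2))
      else 0)"

definition limit_law :: "nat \<Rightarrow> real \<Rightarrow> real measure" where
  "limit_law l r =
     distr (density lborel std_normal_density \<Otimes>\<^sub>M density lborel (chi2_density (l - 1))) borel
       (\<lambda>(z, g). sqrt (1 - r\<^sup>2) * z + r * ((g - real (l - 1)) / sqrt (2 * real (l - 1))))"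

end

theory Submission
  imports Defs "HOL-Real_Asymp.Real_Asymp"
begin

text \<open>
  Conditionally on the categories, \<open>S\<^sub>n\<close> is a sum of independent terms, so its characteristic function
  is an average over the configurations \<open>h\<close> of \<open>\<alpha>^(n - N h) * \<beta>^(N h)\<close> times a phase, where \<open>N h\<close>
  counts the pairs of equal categories and \<open>\<alpha>\<close>, \<open>\<beta>\<close> are the characteristic functions of the centred
  \<open>U\<close> and \<open>V\<close>. Because \<open>N h / n\<close> concentrates at \<open>1 / l\<close>, the powers converge to the Gaussian factor,
  and the phase only involves \<open>N h - n / l\<close>, which is an affine function of Pearson's
  chi-squared statistic \<open>T\<close> of the category counts.

  The convergence of \<open>T\<close> to the chi-squared law with \<open>l - 1\<close> degrees of freedom is obtained without
  a multivariate limit theorem. Writing \<open>exp (- y\<^sup>2 / 2)\<close> as the standard normal characteristic function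
  turns the Laplace transform of \<open>T\<close> into a Gaussian average of \<open>m\<close>-th powers of one-dimensional
  characteristic functions, and dominated convergence applies. Laplace transforms at the integers are the
  moments of \<open>exp (- T)\<close>, which lives on \<open>[0, 1]\<close>, so they determine weak convergence.
\<close>

section \<open>Enumeration of the pairs\<close>

text \<open>Pairs with a common index share a category, so no limit theorem for independent summands
  applies to the \<open>X\<close> directly. The non-Gaussian part survives for a reason of scale:
  \<open>N h - n / l\<close> equals \<open>m / (2 * l)\<close> times \<open>T - (l - 1)\<close>,
  hence has order m, and so does sqrt n, because n = m (m - 1) / 2. Centring \<open>U\<close> and
  \<open>V\<close> at their own means rather than at the mean of \<open>F\<close> moves the random
  level of the sum into a phase of modulus one and leaves powers with a deterministic limit. Their
  exponent is random and can be as large as n, so \<open>\<alpha>\<close> and \<open>\<beta>\<close>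
  must be approximated with an error o(1 / n). The l - 1 degrees of freedom arise as follows: for
  frozen Gaussian weights \<open>g\<close> the m-th powers tend to the exponential of -k times the
  sum of squares of \<open>g\<close> about its mean over l cells, and the Gaussian average of that
  is (1 + 2 k)^(-(l - 1) / 2). The spaces \<open>P m\<close> for different m are unrelated, so only
  laws are compared, and conditioning on the categories is a finite sum over configurations of
  weight l^(-m) each.\<close>

lemma kidx_offset:
  assumes "1 \<le> i" "i < j" "j \<le> m"
  shows "kidx m i j = (\<Sum>a\<in>{1..<i}. m - a) + (j - i)"
proof -
  \<comment> \<open>Twice the number of pairs with first component at most \<open>i\<close>; this
    shows that the \<open>div 2\<close> in \<open>kidx\<close> is exact.\<close>
  have off: "2 * (\<Sum>a\<in>{1..<Suc i}. m - a) = i * (2 * m - 1 - i)" if "i \<le> m" for i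
    using that
  proof (induction i)
    case (Suc i)
    then obtain d where d: "m = Suc i + d" using le_Suc_ex by blast
    have "2 * (\<Sum>a\<in>{1..<Suc i}. m - a) = i * (2 * m - 1 - i)" using Suc by simp
    then have "2 * (\<Sum>a\<in>{1..<Suc (Suc i)}. m - a) = i * (2 * m - 1 - i) + 2 * (m - Suc i)"
      by simp
    also have "\<dots> = Suc i * (2 * m - 1 - Suc i)"
      by (simp add: d algebra_simps)
    finally show ?case .
  qed simp
  have "i * (2 * m - 1) - i ^ 2 = i * (2 * m - 1 - i)"
    by (simp only: power2_eq_square diff_mult_distrib2)
  with off[of i] have eq: "2 * (\<Sum>a\<in>{1..<Suc i}. m - a) = i * (2 * m - 1) - i ^ 2" using assms by simp
  have "kidx m i j = (\<Sum>a\<in>{1..<Suc i}. m - a) + j - m"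
    unfolding kidx_def by (simp only: eq[symmetric])
  \<comment> \<open>Splitting off the last row length \<open>m - i\<close> turns
    \<open>+ j - m\<close> into \<open>+ (j - i)\<close> without truncated subtraction.\<close>
  also have "(\<Sum>a\<in>{1..<Suc i}. m - a) = (\<Sum>a\<in>{1..<i}. m - a) + (m - i)"
    using assms by simp
  finally show ?thesis using assms by simp
qed

lemma sum_diff_eq_choose_2: "(\<Sum>a\<in>{1..<m}. m - a) = m choose 2"
proof -
  have "(\<Sum>a\<in>{1..<m}. m - a) = \<Sum>{1..<m}"
    by (rule sum.reindex_bij_witness[of _ "\<lambda>a. m - a" "\<lambda>a. m - a"]) auto
  also have "\<dots> = m choose 2"
    by (induction m) (auto simp: numeral_2_eq_2)
  finally show ?thesis .
qed

text \<open>The order is lexicographic: the indices of row \<open>i\<close> end at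
  \<open>\<Sum>a\<in>{1..<Suc i}. m - a\<close>, and every later row starts above that.\<close>

lemma kidx_less_kidx:
  assumes "1 \<le> i" "i < j" "j \<le> m" "i < i'" "i' < j'" "j' \<le> m"
  shows "kidx m i j < kidx m i' j'"
proof -
  have "kidx m i j \<le> (\<Sum>a\<in>{1..<i}. m - a) + (m - i)"
    using assms by (simp add: kidx_offset)
  also have "\<dots> = (\<Sum>a\<in>{1..<Suc i}. m - a)"
    using assms by simp
  also have "\<dots> \<le> (\<Sum>a\<in>{1..<i'}. m - a)"
    using assms by (intro sum_mono2) auto
  also have "\<dots> < kidx m i' j'"
    using assms by (simp add: kidx_offset)
  finally show ?thesis .
qed

text \<open>Rows are separated by \<open>kidx_less_kidx\<close>, and inside a row the offset form is
  injective in \<open>j\<close>. Surjectivity follows by counting.\<close>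

lemma bij_betw_kidx:
  "bij_betw (\<lambda>(i, j). kidx m i j) {(i, j). 1 \<le> i \<and> i < j \<and> j \<le> m} {1..m choose 2}"
    (is "bij_betw ?f ?P _")
proof -
  have inj: "inj_on ?f ?P"
  proof (rule inj_onI, clarify)
    fix i j i' j'
    assume *: "1 \<le> i" "i < j" "j \<le> m" "1 \<le> i'" "i' < j'" "j' \<le> m" "kidx m i j = kidx m i' j'"
    then have "i = i'"
      using kidx_less_kidx[of i j m i' j'] kidx_less_kidx[of i' j' m i j] by (cases i i' rule: linorder_cases) auto
    with * show "i = i' \<and> j = j'" by (simp add: kidx_offset)
  qed
  have sub: "?f ` ?P \<subseteq> {1..m choose 2}"
  proof clarify
    fix i j assume *: "1 \<le> i" "i < j" "j \<le> m"
    then have "kidx m i j \<le> (\<Sum>a\<in>{1..<Suc i}. m - a)" by (simp add: kidx_offset)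
    also have "\<dots> \<le> (\<Sum>a\<in>{1..<m}. m - a)" using * by (intro sum_mono2) auto
    finally have "kidx m i j \<le> m choose 2" by (simp only: sum_diff_eq_choose_2)
    with * show "kidx m i j \<in> {1..m choose 2}" by (simp add: kidx_offset)
  qed
  have "?P = (SIGMA i:{1..<m}. {i<..m})" by auto
  then have "card ?P = m choose 2" using sum_diff_eq_choose_2[of m] by simp
  then have "card (?f ` ?P) = card {1..m choose 2}" using card_image[OF inj] by simp
  with sub have "?f ` ?P = {1..m choose 2}" by (intro card_subset_eq) auto
  with inj show ?thesis by (simp add: bij_betw_def)
qed

section \<open>Mixtures driven by random categories\<close>

text \<open>A partition of unity: for a fixed outcome \<open>c\<close> of the labels exactly one
  \<open>h\<close> contributes. Inserting this sum under an expectation plays the part of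
  conditioning on the labels.\<close>

lemma sum_PiE_prod_of_bool_eq:
  fixes c :: "'j \<Rightarrow> 'c"
  assumes "finite J" "finite C" "\<And>j. j \<in> J \<Longrightarrow> c j \<in> C"
  shows "(\<Sum>h\<in>J \<rightarrow>\<^sub>E C. \<Prod>j\<in>J. of_bool (c j = h j)) = (1 :: 'b :: comm_semiring_1)"
proof -
  have "(\<Sum>h\<in>J \<rightarrow>\<^sub>E C. \<Prod>j\<in>J. of_bool (c j = h j)) = (\<Prod>j\<in>J. \<Sum>d\<in>C. of_bool (c j = d) :: 'b)"
    using assms by (subst prod_sum_PiE) auto
  also have "\<dots> = (\<Prod>j\<in>J. 1)"
  proof (rule prod.cong)
    fix j assume "j \<in> J"
    then show "(\<Sum>d\<in>C. of_bool (c j = d) :: 'b) = 1"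
      using assms sum.delta'[of C "c j" "\<lambda>_. 1 :: 'b"] by (simp add: of_bool_def)
  qed simp
  finally show ?thesis by simp
qed

text \<open>One fixed \<open>m\<close>, with the enumeration abstracted away: \<open>p k\<close> and
  \<open>q k\<close> are the end points of the pair numbered \<open>k\<close>. The sum type joins
  labels, \<open>U\<close> and \<open>V\<close> into one family, so that a single
  \<open>indep_vars\<close> expresses their joint independence; the labels are cast to reals to
  share the target \<open>borel\<close>.\<close>

locale categorical_mixture = prob_space M for M :: "'a measure" +
  fixes J :: "'j set" and K :: "'k set" and C :: "nat set"
    and L :: "'j \<Rightarrow> 'a \<Rightarrow> nat" and U V X :: "'k \<Rightarrow> 'a \<Rightarrow> real"
    and p q :: "'k \<Rightarrow> 'j" and \<mu>\<^sub>U \<mu>\<^sub>V :: "real measure"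
  assumes fin: "finite J" "finite K" "finite C" "C \<noteq> {}"
    and L: "\<And>j. j \<in> J \<Longrightarrow> L j \<in> measurable M (count_space UNIV)"
      "\<And>j. j \<in> J \<Longrightarrow> distr M (count_space UNIV) (L j) = measure_pmf (pmf_of_set C)"
    and U: "\<And>k. k \<in> K \<Longrightarrow> U k \<in> borel_measurable M" "\<And>k. k \<in> K \<Longrightarrow> distr M borel (U k) = \<mu>\<^sub>U"
    and V: "\<And>k. k \<in> K \<Longrightarrow> V k \<in> borel_measurable M" "\<And>k. k \<in> K \<Longrightarrow> distr M borel (V k) = \<mu>\<^sub>V"
    and indep: "indep_vars (\<lambda>_. borel)
        (\<lambda>i. case i of Inl j \<Rightarrow> (\<lambda>\<omega>. real (L j \<omega>)) | Inr (Inl k) \<Rightarrow> U k | Inr (Inr k) \<Rightarrow> V k)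
        (Inl ` J \<union> Inr ` Inl ` K \<union> Inr ` Inr ` K)"
    and pq: "\<And>k. k \<in> K \<Longrightarrow> p k \<in> J" "\<And>k. k \<in> K \<Longrightarrow> q k \<in> J"
    and X: "\<And>k. k \<in> K \<Longrightarrow> X k = (\<lambda>\<omega>. if L (p k) \<omega> = L (q k) \<omega> then V k \<omega> else U k \<omega>)"
begin

lemma X_measurable: "k \<in> K \<Longrightarrow> X k \<in> borel_measurable M"
proof -
  assume k: "k \<in> K"
  have "(\<lambda>\<omega>. real (L j \<omega>)) \<in> borel_measurable M" if "j \<in> J" for j
    by (rule measurable_compose[OF L(1)[OF that]]) simp
  note [measurable] = U(1)[OF k] V(1)[OF k] this[OF pq(1)[OF k]] this[OF pq(2)[OF k]]
  have X_eq: "X k = (\<lambda>\<omega>. if real (L (p k) \<omega>) = real (L (q k) \<omega>) then V k \<omega> else U k \<omega>)"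
    by (simp add: X[OF k])
  show ?thesis unfolding X_eq by measurable
qed

text \<open>Once the labels are known to be \<open>h\<close>, each factor depends on one
  \<open>U k\<close> or one \<open>V k\<close>, and independence factorises the expectation. Every
  configuration has probability \<open>1 / card C ^ card J\<close>, whence the divisor. General
  \<open>g k\<close> cover both indicators, for pairwise independence, and exponentials, for the
  limit.\<close>

lemma expectation_prod_mixture:
  fixes g :: "'k \<Rightarrow> real \<Rightarrow> complex"
  assumes g: "\<And>k. k \<in> K \<Longrightarrow> g k \<in> borel_measurable borel" "\<And>k x. k \<in> K \<Longrightarrow> norm (g k x) \<le> 1"
  shows "expectation (\<lambda>\<omega>. \<Prod>k\<in>K. g k (X k \<omega>)) =
    (\<Sum>h\<in>J \<rightarrow>\<^sub>E C. \<Prod>k\<in>K. if h (p k) = h (q k) then (\<integral>x. g k x \<partial>\<mu>\<^sub>V) else (\<integral>x. g k x \<partial>\<mu>\<^sub>U))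
      / of_nat (card C) ^ card J"
proof -
  define I :: "('j + 'k + 'k) set" where "I = Inl ` J \<union> Inr ` Inl ` K \<union> Inr ` Inr ` K"
  \<comment> \<open>Whichever of \<open>U k\<close> and \<open>V k\<close> is not selected by
    \<open>h\<close> receives the constant factor 1, so that for every \<open>h\<close> the product
    runs over the whole independent family.\<close>
  define G :: "('j \<Rightarrow> nat) \<Rightarrow> 'j + 'k + 'k \<Rightarrow> real \<Rightarrow> complex" where
    "G h i x = (case i of Inl j \<Rightarrow> of_bool (x = real (h j))
       | Inr (Inl k) \<Rightarrow> if h (p k) = h (q k) then 1 else g k x
       | Inr (Inr k) \<Rightarrow> if h (p k) = h (q k) then g k x else 1)" for h i x
  define Y where "Y i = (case i of Inl j \<Rightarrow> (\<lambda>\<omega>. real (L j \<omega>)) | Inr (Inl k) \<Rightarrow> U k | Inr (Inr k) \<Rightarrow> V k)"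
    for i
  have [simp]: "finite I" using fin by (simp add: I_def)
  have prod_I: "(\<Prod>i\<in>I. f i) = (\<Prod>j\<in>J. f (Inl j)) * ((\<Prod>k\<in>K. f (Inr (Inl k))) * (\<Prod>k\<in>K. f (Inr (Inr k))))"
    for f :: "_ \<Rightarrow> complex"
  proof -
    have "(Inl ` J \<union> Inr ` Inl ` K) \<inter> Inr ` Inr ` K = ({} :: ('j + 'k + 'k) set)"
      "Inl ` J \<inter> Inr ` Inl ` K = ({} :: ('j + 'k + 'k) set)" by auto
    then show ?thesis
      unfolding I_def using fin
      by (simp add: prod.union_disjoint prod.reindex inj_on_def image_image mult.assoc)
  qed
  have G_meas: "G h i \<in> borel_measurable borel" if "i \<in> I" for h i
    using that g(1) by (auto simp: I_def G_def[abs_def])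
  have Y_meas: "Y i \<in> borel_measurable M" if "i \<in> I" for i
    using that L(1) U(1) V(1) by (auto simp: I_def Y_def)
  have G_bound: "norm (G h i x) \<le> 1" if "i \<in> I" for h i x
    using that g(2) by (auto simp: I_def G_def)
  have GY_indep: "indep_vars (\<lambda>_. borel) (\<lambda>i \<omega>. G h i (Y i \<omega>)) I" for h
    using indep G_meas unfolding Y_def[symmetric] I_def[symmetric]
    by (rule indep_vars_compose2[where X=Y and Y="G h" and N="\<lambda>_. borel" and M'="\<lambda>_. borel"])
  have GY_int: "integrable M (\<lambda>\<omega>. G h i (Y i \<omega>))" if "i \<in> I" for h i
    using that G_bound by (intro integrable_const_bound[of _ 1] measurable_compose[OF Y_meas G_meas]) auto
  have E_prod: "expectation (\<lambda>\<omega>. \<Prod>i\<in>I. G h i (Y i \<omega>)) = (\<Prod>i\<in>I. expectation (\<lambda>\<omega>. G h i (Y i \<omega>)))"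
    and int_prod: "integrable M (\<lambda>\<omega>. \<Prod>i\<in>I. G h i (Y i \<omega>))" for h
    using GY_int by (auto intro!: indep_vars_lebesgue_integral indep_vars_integrable GY_indep)
  have E_L: "expectation (\<lambda>\<omega>. G h (Inl j) (Y (Inl j) \<omega>)) = 1 / of_nat (card C)" if "j \<in> J" "h j \<in> C" for h j
  proof -
    have "expectation (\<lambda>\<omega>. G h (Inl j) (Y (Inl j) \<omega>)) = expectation (\<lambda>\<omega>. of_bool (L j \<omega> = h j))"
      by (simp add: G_def Y_def)
    also have "\<dots> = (\<integral>x. of_bool (x = h j) \<partial>distr M (count_space UNIV) (L j))"
      using L(1)[OF that(1)] by (subst integral_distr) auto
    also have "\<dots> = (\<integral>x. of_bool (x = h j) \<partial>measure_pmf (pmf_of_set C))"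
      by (simp only: L(2)[OF that(1)])
    also have "\<dots> = 1 / of_nat (card C)"
      using fin that by (subst integral_measure_pmf[of C]) (auto simp: scaleR_conv_of_real of_bool_def if_distrib cong: if_cong)
    finally show ?thesis .
  qed
  have E_UV: "expectation (\<lambda>\<omega>. g k (U k \<omega>)) = (\<integral>x. g k x \<partial>\<mu>\<^sub>U)"
    "expectation (\<lambda>\<omega>. g k (V k \<omega>)) = (\<integral>x. g k x \<partial>\<mu>\<^sub>V)" if "k \<in> K" for k
    using integral_distr[OF U(1)[OF that] g(1)[OF that]] integral_distr[OF V(1)[OF that] g(1)[OF that]]
    by (simp_all only: U(2)[OF that] V(2)[OF that])
  have E_h: "expectation (\<lambda>\<omega>. \<Prod>i\<in>I. G h i (Y i \<omega>)) =
     (\<Prod>k\<in>K. if h (p k) = h (q k) then (\<integral>x. g k x \<partial>\<mu>\<^sub>V) else (\<integral>x. g k x \<partial>\<mu>\<^sub>U)) / of_nat (card C) ^ card J"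
    if "h \<in> J \<rightarrow>\<^sub>E C" for h
  proof -
    have "(\<Prod>j\<in>J. expectation (\<lambda>\<omega>. G h (Inl j) (Y (Inl j) \<omega>))) = (\<Prod>j\<in>J. 1 / of_nat (card C))"
      using that by (intro prod.cong E_L) auto
    moreover have "(\<Prod>k\<in>K. expectation (\<lambda>\<omega>. G h (Inr (Inl k)) (Y (Inr (Inl k)) \<omega>))) *
        (\<Prod>k\<in>K. expectation (\<lambda>\<omega>. G h (Inr (Inr k)) (Y (Inr (Inr k)) \<omega>))) =
        (\<Prod>k\<in>K. if h (p k) = h (q k) then (\<integral>x. g k x \<partial>\<mu>\<^sub>V) else (\<integral>x. g k x \<partial>\<mu>\<^sub>U))"
      unfolding prod.distrib[symmetric]
      by (rule prod.cong) (auto simp: G_def Y_def E_UV prob_space)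
    ultimately show ?thesis unfolding E_prod unfolding prod_I by (simp add: power_one_over)
  qed
  \<comment> \<open>Only the law of the labels is given, so they lie in \<open>C\<close> merely
    almost surely; \<open>split\<close> is therefore applied under
    \<open>integral_cong_AE\<close>.\<close>
  have L_AE: "AE \<omega> in M. \<forall>j\<in>J. L j \<omega> \<in> C"
  proof (rule AE_finite_allI)
    fix j assume j: "j \<in> J"
    have "AE x in distr M (count_space UNIV) (L j). x \<in> C"
      unfolding L(2)[OF j] using fin by (simp add: AE_measure_pmf_iff)
    then show "AE \<omega> in M. L j \<omega> \<in> C" using L(1)[OF j] by (subst (asm) AE_distr_iff) auto
  qed (rule fin)
  have split: "(\<Prod>k\<in>K. g k (X k \<omega>)) = (\<Sum>h\<in>J \<rightarrow>\<^sub>E C. \<Prod>i\<in>I. G h i (Y i \<omega>))"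
    if "\<forall>j\<in>J. L j \<omega> \<in> C" for \<omega>
  proof -
    have "(\<Prod>k\<in>K. g k (X k \<omega>)) =
      (\<Sum>h\<in>J \<rightarrow>\<^sub>E C. \<Prod>j\<in>J. of_bool (L j \<omega> = h j)) * (\<Prod>k\<in>K. g k (X k \<omega>))"
      using that fin by (subst sum_PiE_prod_of_bool_eq) auto
    also have "\<dots> = (\<Sum>h\<in>J \<rightarrow>\<^sub>E C. (\<Prod>j\<in>J. of_bool (L j \<omega> = h j)) * (\<Prod>k\<in>K. g k (X k \<omega>)))"
      by (rule sum_distrib_right)
    also have "\<dots> = (\<Sum>h\<in>J \<rightarrow>\<^sub>E C. \<Prod>i\<in>I. G h i (Y i \<omega>))"
    proof (rule sum.cong)
      fix h assume "h \<in> J \<rightarrow>\<^sub>E C"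
      show "(\<Prod>j\<in>J. of_bool (L j \<omega> = h j)) * (\<Prod>k\<in>K. g k (X k \<omega>)) = (\<Prod>i\<in>I. G h i (Y i \<omega>))"
      proof (cases "\<forall>j\<in>J. L j \<omega> = h j")
        case True
        then have "(\<Prod>k\<in>K. g k (X k \<omega>)) = (\<Prod>k\<in>K. G h (Inr (Inl k)) (U k \<omega>) * G h (Inr (Inr k)) (V k \<omega>))"
          using pq by (intro prod.cong) (auto simp: X G_def)
        with True show ?thesis unfolding prod_I by (simp add: G_def Y_def prod.distrib)
      next
        case False
        then have "(\<Prod>j\<in>J. of_bool (L j \<omega> = h j)) = (0::complex)" using fin by auto
        moreover have "(\<Prod>j\<in>J. G h (Inl j) (Y (Inl j) \<omega>)) = 0" using False fin by (auto simp: G_def Y_def)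
        ultimately show ?thesis unfolding prod_I by simp
      qed
    qed simp
    finally show ?thesis .
  qed
  have "expectation (\<lambda>\<omega>. \<Prod>k\<in>K. g k (X k \<omega>)) = expectation (\<lambda>\<omega>. \<Sum>h\<in>J \<rightarrow>\<^sub>E C. \<Prod>i\<in>I. G h i (Y i \<omega>))"
    using L_AE split
    by (intro integral_cong_AE borel_measurable_prod borel_measurable_sum
        measurable_compose[OF X_measurable g(1)] measurable_compose[OF Y_meas G_meas]) auto
  also have "\<dots> = (\<Sum>h\<in>J \<rightarrow>\<^sub>E C. expectation (\<lambda>\<omega>. \<Prod>i\<in>I. G h i (Y i \<omega>)))"
    using int_prod by (rule Bochner_Integration.integral_sum)
  also have "\<dots> = (\<Sum>h\<in>J \<rightarrow>\<^sub>E C. (\<Prod>k\<in>K. if h (p k) = h (q k) then (\<integral>x. g k x \<partial>\<mu>\<^sub>V) else (\<integral>x. g k x \<partial>\<mu>\<^sub>U))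
      / of_nat (card C) ^ card J)"
    by (intro sum.cong E_h) auto
  finally show ?thesis by (simp add: sum_divide_distrib)
qed
end

section \<open>Sums over configurations and pairwise independence\<close>

lemma sum_PiE_remove:
  fixes F :: "('j \<Rightarrow> 'c) \<Rightarrow> 'b :: comm_monoid_add"
  assumes "x \<in> J"
  shows "(\<Sum>h\<in>J \<rightarrow>\<^sub>E C. F h) = (\<Sum>h\<in>(J - {x}) \<rightarrow>\<^sub>E C. \<Sum>c\<in>C. F (h(x := c)))"
proof -
  have J: "J = insert x (J - {x})" using assms by auto
  have "(\<Sum>h\<in>J \<rightarrow>\<^sub>E C. F h) = (\<Sum>(c, h)\<in>C \<times> ((J - {x}) \<rightarrow>\<^sub>E C). F (h(x := c)))"
    using inj_combinator[of x "J - {x}" "\<lambda>_. C"]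
    by (subst J, subst PiE_insert_eq, subst sum.reindex) (auto simp: case_prod_beta')
  also have "\<dots> = (\<Sum>c\<in>C. \<Sum>h\<in>(J - {x}) \<rightarrow>\<^sub>E C. F (h(x := c)))"
    by (rule sum.cartesian_product[symmetric])
  finally show ?thesis by (subst (asm) sum.swap)
qed

text \<open>The source of pairwise independence: with all coordinates except \<open>x\<close>
  frozen, exactly one of the \<open>card C\<close> values at \<open>x\<close> agrees with
  \<open>h y\<close>, so the match factor averages to the same number whatever the other coordinates
  are, and \<open>f\<close> does not see \<open>x\<close>.\<close>

lemma sum_PiE_match:
  fixes f :: "('j \<Rightarrow> 'c) \<Rightarrow> complex"
  assumes C: "finite C" "C \<noteq> {}" and xy: "x \<in> J" "y \<in> J" "x \<noteq> y"
    and f: "\<And>h c. f (h(x := c)) = f h"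
  shows "(\<Sum>h\<in>J \<rightarrow>\<^sub>E C. f h * (if h x = h y then a else b)) =
    (\<Sum>h\<in>J \<rightarrow>\<^sub>E C. f h) * ((a + of_nat (card C - 1) * b) / of_nat (card C))"
proof -
  have "(\<Sum>h\<in>J \<rightarrow>\<^sub>E C. f h * (if h x = h y then a else b)) =
      (\<Sum>h\<in>(J - {x}) \<rightarrow>\<^sub>E C. f h * (\<Sum>c\<in>C. if c = h y then a else b))"
    using xy by (subst sum_PiE_remove[of x]) (auto simp: f sum_distrib_left)
  also have "\<dots> = (\<Sum>h\<in>(J - {x}) \<rightarrow>\<^sub>E C. f h * (a + of_nat (card C - 1) * b))"
  proof (rule sum.cong)
    fix h assume "h \<in> (J - {x}) \<rightarrow>\<^sub>E C"
    then have "h y \<in> C" using xy by auto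
    then have "(\<Sum>c\<in>C. if c = h y then a else b) = a + (\<Sum>c\<in>C - {h y}. if c = h y then a else b)"
      using C by (simp add: sum.remove)
    also have "(\<Sum>c\<in>C - {h y}. if c = h y then a else b) = (\<Sum>c\<in>C - {h y}. b)"
      by (rule sum.cong) auto
    finally show "f h * (\<Sum>c\<in>C. if c = h y then a else b) = f h * (a + of_nat (card C - 1) * b)"
      using C \<open>h y \<in> C\<close> by simp
  qed simp
  also have "\<dots> = (\<Sum>h\<in>(J - {x}) \<rightarrow>\<^sub>E C. f h) * (a + of_nat (card C - 1) * b)"
    by (rule sum_distrib_right[symmetric])
  also have "(\<Sum>h\<in>(J - {x}) \<rightarrow>\<^sub>E C. f h) = (\<Sum>h\<in>J \<rightarrow>\<^sub>E C. f h) / of_nat (card C)"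
    using xy C by (subst (2) sum_PiE_remove[of x]) (auto simp: f sum_distrib_left[symmetric])
  finally show ?thesis by simp
qed

lemma (in prob_space) indep_var_of_prob_eq:
  assumes rvs: "random_variable S X" "random_variable T Y"
    and eq: "\<And>A B. A \<in> sets S \<Longrightarrow> B \<in> sets T \<Longrightarrow>
      prob ((X -` A \<inter> space M) \<inter> (Y -` B \<inter> space M)) = prob (X -` A \<inter> space M) * prob (Y -` B \<inter> space M)"
  shows "indep_var S X T Y"
  unfolding indep_var_eq
proof (intro conjI indep_set_sigma_sets rvs)
  show "indep_set {X -` A \<inter> space M |A. A \<in> sets S} {Y -` A \<inter> space M |A. A \<in> sets T}"
    using rvs eq by (auto intro!: indep_setI measurable_sets)
  show "Int_stable {X -` A \<inter> space M |A. A \<in> sets S}"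
    unfolding Int_stable_def by (clarify, rule_tac x="A \<inter> Aa" in exI) auto
  show "Int_stable {Y -` A \<inter> space M |A. A \<in> sets T}"
    unfolding Int_stable_def by (clarify, rule_tac x="A \<inter> Aa" in exI) auto
qed

context categorical_mixture
begin

text \<open>Of two different pairs, the first has an end point \<open>x\<close> outside the second.
  Summing over the label at \<open>x\<close> makes the first pair match with probability
  \<open>1 / card C\<close>, whatever the labels that determine \<open>X k2\<close> are.\<close>

lemma indep_var_mixture:
  assumes k: "k1 \<in> K" "k2 \<in> K" and ne: "p k1 \<noteq> q k1" "p k2 \<noteq> q k2"
    and pairs: "{p k1, q k1} \<noteq> {p k2, q k2}"
  shows "indep_var borel (X k1) borel (X k2)"
proof (rule indep_var_of_prob_eq)
  have k12: "k1 \<noteq> k2" using pairs by auto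
  obtain x y where xy: "{x, y} = {p k1, q k1}" "x \<noteq> p k2" "x \<noteq> q k2" "x \<noteq> y" "x \<in> J" "y \<in> J"
  proof (cases "p k1 \<in> {p k2, q k2}")
    case True
    then have "q k1 \<notin> {p k2, q k2}" using pairs ne by auto
    with that[of "q k1" "p k1"] show ?thesis using ne(1) pq[OF k(1)] by (auto simp: insert_commute)
  next
    case False
    with that[of "p k1" "q k1"] show ?thesis using ne(1) pq[OF k(1)] by auto
  qed
  fix A B :: "real set" assume AB[measurable]: "A \<in> sets borel" "B \<in> sets borel"
  define w where "w S h k = (if h (p k) = h (q k) then complex_of_real (measure \<mu>\<^sub>V S) else measure \<mu>\<^sub>U S)"
    for S and h :: "'j \<Rightarrow> nat" and k
  note [measurable] = X_measurable[OF k(1)] X_measurable[OF k(2)]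
  interpret \<mu>\<^sub>U: real_distribution \<mu>\<^sub>U
    using real_distribution_distr[OF U(1)[OF k(1)]] by (simp only: U(2)[OF k(1)])
  interpret \<mu>\<^sub>V: real_distribution \<mu>\<^sub>V
    using real_distribution_distr[OF V(1)[OF k(1)]] by (simp only: V(2)[OF k(1)])
  \<comment> \<open>Stated for all \<open>A\<close> and \<open>B\<close>: the marginals are the
    instances in which one of them is \<open>UNIV\<close>.\<close>
  have joint: "complex_of_real (prob ((X k1 -` A \<inter> space M) \<inter> (X k2 -` B \<inter> space M))) =
      (\<Sum>h\<in>J \<rightarrow>\<^sub>E C. w A h k1 * w B h k2) / of_nat (card C) ^ card J"
    if [measurable]: "A \<in> sets borel" "B \<in> sets borel" for A B
  proof -
    define g where "g k x = complex_of_real (indicator (if k = k1 then A else if k = k2 then B else UNIV) x)"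
      for k and x :: real
    have prod_K: "(\<Prod>k\<in>K. f k) = f k1 * f k2" if "\<And>k. k \<in> K \<Longrightarrow> k \<noteq> k1 \<Longrightarrow> k \<noteq> k2 \<Longrightarrow> f k = 1"
      for f :: "'k \<Rightarrow> complex"
    proof -
      have "(\<Prod>k\<in>K. f k) = (\<Prod>k\<in>{k1, k2}. f k)"
        using that k fin by (intro prod.mono_neutral_right) auto
      then show ?thesis using k12 by simp
    qed
    have "complex_of_real (prob ((X k1 -` A \<inter> space M) \<inter> (X k2 -` B \<inter> space M))) =
       expectation (\<lambda>\<omega>. of_real (indicator ((X k1 -` A \<inter> space M) \<inter> (X k2 -` B \<inter> space M)) \<omega>))"
      unfolding integral_complex_of_real by (simp add: Int_assoc)
    also have "\<dots> = expectation (\<lambda>\<omega>. \<Prod>k\<in>K. g k (X k \<omega>))"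
    proof (rule Bochner_Integration.integral_cong)
      fix \<omega> assume "\<omega> \<in> space M"
      then show "of_real (indicator ((X k1 -` A \<inter> space M) \<inter> (X k2 -` B \<inter> space M)) \<omega>) = (\<Prod>k\<in>K. g k (X k \<omega>))"
        using k12 by (subst prod_K) (auto simp: g_def indicator_def)
    qed simp
    finally have "complex_of_real (prob ((X k1 -` A \<inter> space M) \<inter> (X k2 -` B \<inter> space M))) =
        expectation (\<lambda>\<omega>. \<Prod>k\<in>K. g k (X k \<omega>))" .
    moreover have "expectation (\<lambda>\<omega>. \<Prod>k\<in>K. g k (X k \<omega>)) =
        (\<Sum>h\<in>J \<rightarrow>\<^sub>E C. \<Prod>k\<in>K. if h (p k) = h (q k) then (\<integral>x. g k x \<partial>\<mu>\<^sub>V) else (\<integral>x. g k x \<partial>\<mu>\<^sub>U))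
        / of_nat (card C) ^ card J"
      by (rule expectation_prod_mixture) (auto simp: g_def[abs_def] indicator_def)
    moreover have "(\<Prod>k\<in>K. if h (p k) = h (q k) then (\<integral>x. g k x \<partial>\<mu>\<^sub>V) else (\<integral>x. g k x \<partial>\<mu>\<^sub>U)) =
        w A h k1 * w B h k2" for h
      using k12 \<mu>\<^sub>U.prob_space \<mu>\<^sub>V.prob_space
      by (subst prod_K) (auto simp: g_def[abs_def] w_def)
    ultimately show ?thesis by (simp only:)
  qed
  show "prob ((X k1 -` A \<inter> space M) \<inter> (X k2 -` B \<inter> space M)) =
      prob (X k1 -` A \<inter> space M) * prob (X k2 -` B \<inter> space M)"
  proof -
    \<comment> \<open>The mass of \<open>A\<close> under the mixture of \<open>\<mu>\<^sub>V\<close>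
      with weight \<open>1 / card C\<close> and \<open>\<mu>\<^sub>U\<close> with the remaining
      weight; it will factor out of the sum over configurations.\<close>
    define a where "a = (complex_of_real (measure \<mu>\<^sub>V A) + of_nat (card C - 1) * measure \<mu>\<^sub>U A) / of_nat (card C)"
    let ?l = "of_nat (card C) ^ card J :: complex"
    have "w B (h(x := c)) k2 = w B h k2" for h c B
      using xy by (simp add: w_def)
    moreover have "w A h k1 = (if h x = h y then complex_of_real (measure \<mu>\<^sub>V A) else measure \<mu>\<^sub>U A)" for h
      using xy(1) by (auto simp: w_def doubleton_eq_iff)
    ultimately have split: "(\<Sum>h\<in>J \<rightarrow>\<^sub>E C. w A h k1 * w B h k2) = (\<Sum>h\<in>J \<rightarrow>\<^sub>E C. w B h k2) * a" for B
      using sum_PiE_match[OF fin(3,4) xy(5,6,4), of "\<lambda>h. w B h k2"] by (simp add: a_def mult.commute)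
    have w1: "w UNIV h k = 1" for h k
      using \<mu>\<^sub>U.prob_space \<mu>\<^sub>V.prob_space by (simp add: w_def)
    have l: "(\<Sum>h\<in>J \<rightarrow>\<^sub>E C. 1) = ?l" "?l \<noteq> 0"
      using fin by (auto simp: card_PiE)
    have "complex_of_real (prob (X k1 -` A \<inter> space M)) = a"
      using joint[of A UNIV] split[of UNIV] l by (simp add: w1 Int_absorb2)
    moreover have "complex_of_real (prob (X k2 -` B \<inter> space M)) = (\<Sum>h\<in>J \<rightarrow>\<^sub>E C. w B h k2) / ?l"
      using joint[of UNIV B] by (simp add: w1 Int_absorb1)
    ultimately have "complex_of_real (prob ((X k1 -` A \<inter> space M) \<inter> (X k2 -` B \<inter> space M))) =
        complex_of_real (prob (X k1 -` A \<inter> space M) * prob (X k2 -` B \<inter> space M))"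
      using joint[of A B] split[of B] by simp
    then show ?thesis by (simp only: of_real_eq_iff)
  qed
qed (use k in \<open>auto intro: X_measurable\<close>)

end

section \<open>Characteristic functions of small arguments\<close>

text \<open>The rate o(1 / n) is needed because the error is later multiplied by an exponent of size
  up to n. The comparison is with \<open>exp (- c / n)\<close> instead of \<open>1 - c / n\<close>,
  since its powers are again exact exponentials.\<close>

lemma (in real_distribution) char_scaled_approx:
  assumes i1: "integrable M (\<lambda>x. x)" and e1: "expectation (\<lambda>x. x) = 0"
    and i2: "integrable M (\<lambda>x. x\<^sup>2)" and e2: "expectation (\<lambda>x. x\<^sup>2) = v"
  shows "(\<lambda>n. real n * norm (char M (s / sqrt (real n)) - of_real (exp (- (s\<^sup>2 * v / 2) / real n))))
           \<longlonglongrightarrow> 0"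
proof (rule Lim_null_comparison)
  \<comment> \<open>The minimum in the Taylor remainder is dominated by \<open>6 * x\<^sup>2\<close>
    and tends to 0 pointwise, so that second moments suffice for dominated convergence.\<close>
  let ?r = "\<lambda>n. s\<^sup>2 / 6 * (LINT x|M. min (6 * x\<^sup>2) (\<bar>s / sqrt (real n)\<bar> * \<bar>x\<bar> ^ 3))"
  let ?q = "\<lambda>n. real n * \<bar>1 - (s\<^sup>2 * v / 2) / real n - exp (- (s\<^sup>2 * v / 2) / real n)\<bar>"
  have "norm (real n * norm (char M (s / sqrt (real n)) - of_real (exp (- (s\<^sup>2 * v / 2) / real n))))
      \<le> ?r n + ?q n" if "n \<ge> 1" for n
  proof -
    let ?t = "s / sqrt (real n)"
    have "norm (char M ?t - of_real (exp (- (s\<^sup>2 * v / 2) / real n))) \<le>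
        norm (char M ?t - (1 - ?t\<^sup>2 * v / 2))
        + norm ((1 - ?t\<^sup>2 * v / 2) - of_real (exp (- (s\<^sup>2 * v / 2) / real n)) :: complex)"
      by (rule order_trans[OF _ norm_triangle_ineq]) simp
    also have "norm (char M ?t - (1 - ?t\<^sup>2 * v / 2)) \<le>
        ?t\<^sup>2 / 6 * (LINT x|M. min (6 * x\<^sup>2) (\<bar>?t\<bar> * \<bar>x\<bar> ^ 3))"
      by (rule char_approx3) (use assms in auto)
    also have "?t\<^sup>2 = s\<^sup>2 / real n" by (simp add: power_divide)
    also have "norm ((1 - (s\<^sup>2 / real n) * v / 2) - of_real (exp (- (s\<^sup>2 * v / 2) / real n)) :: complex)
       = \<bar>1 - (s\<^sup>2 * v / 2) / real n - exp (- (s\<^sup>2 * v / 2) / real n)\<bar>"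
      unfolding norm_of_real[where 'a=complex, symmetric]
      by (rule arg_cong[where f=norm]) simp
    finally have "norm (char M ?t - of_real (exp (- (s\<^sup>2 * v / 2) / real n))) \<le>
      s\<^sup>2 / real n / 6 * (LINT x|M. min (6 * x\<^sup>2) (\<bar>?t\<bar> * \<bar>x\<bar> ^ 3)) +
      \<bar>1 - (s\<^sup>2 * v / 2) / real n - exp (- (s\<^sup>2 * v / 2) / real n)\<bar>" by simp
    from mult_left_mono[OF this, of "real n"] have
      "real n * norm (char M ?t - of_real (exp (- (s\<^sup>2 * v / 2) / real n))) \<le> 
       real n * (s\<^sup>2 / real n / 6 * (LINT x|M. min (6 * x\<^sup>2) (\<bar>?t\<bar> * \<bar>x\<bar> ^ 3))) + ?q n"
      by (simp only: distrib_left of_nat_0_le_iff)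
    moreover have "real n * (s\<^sup>2 / real n / 6 * I) = s\<^sup>2 / 6 * I" for I
      using that by simp
    ultimately show ?thesis using that by simp
  qed
  then show "\<forall>\<^sub>F n in sequentially. norm (real n * norm (char M (s / sqrt (real n)) -
       of_real (exp (- (s\<^sup>2 * v / 2) / real n)))) \<le> ?r n + ?q n"
    by (rule eventually_sequentiallyI)
  have "(\<lambda>n. min (6 * x\<^sup>2) (\<bar>s / sqrt (real n)\<bar> * \<bar>x\<bar> ^ 3)) \<longlonglongrightarrow> min (6 * x\<^sup>2) (0 * \<bar>x\<bar> ^ 3)" for x
  proof (intro tendsto_intros)
    have "(\<lambda>n. s / sqrt (real n)) \<longlonglongrightarrow> 0" by real_asymp
    then show "(\<lambda>n. \<bar>s / sqrt (real n)\<bar>) \<longlonglongrightarrow> 0" by (rule tendsto_rabs_zero)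
  qed
  then have "(\<lambda>n. LINT x|M. min (6 * x\<^sup>2) (\<bar>s / sqrt (real n)\<bar> * \<bar>x\<bar> ^ 3)) \<longlonglongrightarrow> (LINT x|M. 0)"
    by (intro integral_dominated_convergence [where w = "\<lambda>x. 6 * x^2"]) (use i2 in auto)
  then have 1: "?r \<longlonglongrightarrow> 0" by (simp only: integral_zero tendsto_mult_right_zero)
  define c where "c = s\<^sup>2 * v / 2"
  have "(\<lambda>n. real n * (1 - c / real n - exp (- c / real n))) \<longlonglongrightarrow> 0" by real_asymp
  then have "(\<lambda>n. \<bar>real n * (1 - c / real n - exp (- c / real n))\<bar>) \<longlonglongrightarrow> 0"
    by (rule tendsto_rabs_zero)
  then have 2: "?q \<longlonglongrightarrow> 0" by (simp add: abs_mult c_def)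
  show "(\<lambda>n. ?r n + ?q n) \<longlonglongrightarrow> 0" using tendsto_add[OF 1 2] by simp
qed

text \<open>For numbers of norm at most 1, n-th powers differ by at most n times the difference of
  the bases. The variance \<open>v\<close> may be 0, as happens later when all values
  \<open>g c\<close> coincide.\<close>

lemma (in real_distribution) char_scaled_power_tendsto:
  assumes "integrable M (\<lambda>x. x)" "expectation (\<lambda>x. x) = 0"
    and "integrable M (\<lambda>x. x\<^sup>2)" "expectation (\<lambda>x. x\<^sup>2) = v"
  shows "(\<lambda>n. char M (s / sqrt (real n)) ^ n) \<longlonglongrightarrow> of_real (exp (- (s\<^sup>2 * v / 2)))"
proof -
  have v: "v \<ge> 0" using assms(4) by (auto intro!: integral_nonneg_AE)
  have "\<forall>\<^sub>F n in sequentially. norm (char M (s / sqrt (real n)) ^ n - of_real (exp (- (s\<^sup>2 * v / 2))))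
     \<le> real n * norm (char M (s / sqrt (real n)) - of_real (exp (- (s\<^sup>2 * v / 2) / real n)))"
  proof (rule eventually_sequentiallyI)
    fix n :: nat assume n: "1 \<le> n"
    have "exp (- (s\<^sup>2 * v / 2)) = exp (- (s\<^sup>2 * v / 2) / real n) ^ n"
      unfolding exp_of_nat_mult[symmetric] using n by simp
    then have "norm (char M (s / sqrt (real n)) ^ n - of_real (exp (- (s\<^sup>2 * v / 2)))) =
       norm (char M (s / sqrt (real n)) ^ n - (of_real (exp (- (s\<^sup>2 * v / 2) / real n))) ^ n)"
      by (simp only: of_real_power)
    also have "\<dots> \<le> real n * norm (char M (s / sqrt (real n)) - of_real (exp (- (s\<^sup>2 * v / 2) / real n)))"
      using v by (intro norm_power_diff cmod_char_le_1) auto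
    finally show "norm (char M (s / sqrt (real n)) ^ n - of_real (exp (- (s\<^sup>2 * v / 2)))) \<le> \<dots>" .
  qed
  then have "(\<lambda>n. char M (s / sqrt (real n)) ^ n - of_real (exp (- (s\<^sup>2 * v / 2)))) \<longlonglongrightarrow> 0"
    by (rule Lim_null_comparison) (rule char_scaled_approx[OF assms])
  then show ?thesis by (rule LIM_zero_cancel)
qed

section \<open>Weak convergence from Laplace transforms\<close>

text \<open>By Weierstrass approximation, moments on \<open>[0, 1]\<close> control the integral of
  every continuous function. Cosine and sine then give the characteristic functions, and Levy's
  theorem applies.\<close>

lemma weak_conv_m_moments_unit_interval:
  fixes M :: "nat \<Rightarrow> real measure" and N :: "real measure"
  assumes M: "\<And>n. real_distribution (M n)" and N: "real_distribution N"
    and M01: "\<And>n. AE x in M n. x \<in> {0..1}" and N01: "AE x in N. x \<in> {0..1}"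
    and moments: "\<And>k::nat. (\<lambda>n. \<integral>x. x ^ k \<partial>M n) \<longlonglongrightarrow> (\<integral>x. x ^ k \<partial>N)"
  shows "weak_conv_m M N"
proof (rule levy_continuity[OF M N])
  fix t :: real
  have int: "integrable D f" if "real_distribution D" "AE x in D. x \<in> {0..1}" "continuous_on UNIV f"
    for D and f :: "real \<Rightarrow> real"
  proof -
    interpret real_distribution D by fact
    have "bounded (f ` {0..1})"
      using that(3) by (intro compact_imp_bounded compact_continuous_image continuous_on_subset[OF that(3)]) auto
    then obtain B where "\<forall>x\<in>{0..1}. norm (f x) \<le> B" by (auto simp: bounded_iff)
    moreover have "f \<in> borel_measurable D"
      using that(3) by (simp add: borel_measurable_continuous_onI)
    ultimately show ?thesis
      using that(2) by (intro integrable_const_bound[of _ B]) auto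
  qed
  have conv: "(\<lambda>n. \<integral>x. f x \<partial>M n) \<longlonglongrightarrow> (\<integral>x. f x \<partial>N)" if f: "continuous_on UNIV f" for f :: "real \<Rightarrow> real"
  proof (rule LIMSEQ_I)
    fix e :: real assume e: "0 < e"
    obtain g where g: "real_polynomial_function g" "\<And>x. x \<in> {0..1} \<Longrightarrow> \<bar>f x - g x\<bar> < e / 3"
      using Stone_Weierstrass_real_polynomial_function[of "{0..1}" f "e / 3"] e continuous_on_subset[OF f]
      by auto
    then obtain a d where g_eq: "g = (\<lambda>x. \<Sum>i\<le>d. a i * x ^ i)"
      by (auto simp: real_polynomial_function_iff_sum)
    have g_cont: "continuous_on UNIV g" unfolding g_eq by (intro continuous_intros)
    have g_int: "(\<integral>x. g x \<partial>D) = (\<Sum>i\<le>d. a i * (\<integral>x. x ^ i \<partial>D))"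
      if "real_distribution D" "AE x in D. x \<in> {0..1}" for D
    proof -
      have "integrable D (\<lambda>x. x ^ i)" for i by (intro int[OF that] continuous_intros)
      then show ?thesis unfolding g_eq by (subst Bochner_Integration.integral_sum) auto
    qed
    \<comment> \<open>The bound is uniform in the measure \<open>D\<close>, so one polynomial
      \<open>g\<close> serves every \<open>M n\<close> and \<open>N\<close>.\<close>
    have close: "\<bar>(\<integral>x. f x \<partial>D) - (\<integral>x. g x \<partial>D)\<bar> \<le> e / 3"
      if D: "real_distribution D" "AE x in D. x \<in> {0..1}" for D
    proof -
      interpret real_distribution D by fact
      have "\<bar>(\<integral>x. f x \<partial>D) - (\<integral>x. g x \<partial>D)\<bar> = \<bar>\<integral>x. f x - g x \<partial>D\<bar>"
        using int[OF D f] int[OF D g_cont] by simp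
      also have "\<dots> \<le> (\<integral>x. \<bar>f x - g x\<bar> \<partial>D)" by (rule integral_abs_bound)
      also have "\<dots> \<le> (\<integral>x. e / 3 \<partial>D)"
        using D(2) g(2) int[OF D f] int[OF D g_cont]
        by (intro integral_mono_AE) (auto intro: less_imp_le)
      finally show ?thesis using prob_space by simp
    qed
    have "(\<lambda>n. \<integral>x. g x \<partial>M n) \<longlonglongrightarrow> (\<integral>x. g x \<partial>N)"
      unfolding g_int[OF M M01] g_int[OF N N01] by (intro tendsto_intros moments)
    then obtain n0 where "\<And>n. n \<ge> n0 \<Longrightarrow> \<bar>(\<integral>x. g x \<partial>M n) - (\<integral>x. g x \<partial>N)\<bar> < e / 3"
      using e LIMSEQ_D[of "\<lambda>n. \<integral>x. g x \<partial>M n" _ "e / 3"] by auto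
    then have "\<bar>(\<integral>x. f x \<partial>M n) - (\<integral>x. f x \<partial>N)\<bar> < e" if "n \<ge> n0" for n
      using close[OF M M01, of n] close[OF N N01] that unfolding abs_less_iff abs_le_iff
      by fastforce
    then show "\<exists>no. \<forall>n\<ge>no. norm ((\<integral>x. f x \<partial>M n) - (\<integral>x. f x \<partial>N)) < e" by auto
  qed
  have char_eq: "Re (char D t) = (\<integral>x. cos (t * x) \<partial>D)" "Im (char D t) = (\<integral>x. sin (t * x) \<partial>D)"
    if "real_distribution D" for D
  proof -
    interpret real_distribution D by fact
    have "integrable D (\<lambda>x. iexp (t * x))" by (intro integrable_const_bound[of _ 1]) auto
    then show "Re (char D t) = (\<integral>x. cos (t * x) \<partial>D)" "Im (char D t) = (\<integral>x. sin (t * x) \<partial>D)"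
      by (simp_all add: char_def Re_exp Im_exp flip: integral_Re integral_Im)
  qed
  show "(\<lambda>n. char (M n) t) \<longlonglongrightarrow> char N t"
    unfolding tendsto_complex_iff char_eq[OF M] char_eq[OF N]
    by (intro conjI conv continuous_intros)
qed

text \<open>The map sending \<open>x\<close> to \<open>exp (- x)\<close> turns integer Laplace
  transforms into moments on \<open>[0, 1]\<close>. On the way back the character becomes
  \<open>iexp (- t * ln x)\<close>, which can be discontinuous only at 0, a point without mass
  because the exponential never vanishes.\<close>

lemma char_tendsto_laplace:
  fixes M :: "nat \<Rightarrow> real measure" and N :: "real measure"
  assumes M: "\<And>n. real_distribution (M n)" and N: "real_distribution N"
    and M0: "\<And>n. AE x in M n. 0 \<le> x" and N0: "AE x in N. 0 \<le> x"
    and laplace: "\<And>k::nat. (\<lambda>n. \<integral>x. exp (- (real k * x)) \<partial>M n) \<longlonglongrightarrow> (\<integral>x. exp (- (real k * x)) \<partial>N)"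
  shows "(\<lambda>n. char (M n) t) \<longlonglongrightarrow> char N t"
proof -
  define E where "E D = distr D borel (\<lambda>x. exp (- x))" for D :: "real measure"
  have E: "real_distribution (E D)" if "real_distribution D" for D
  proof -
    interpret real_distribution D by fact
    show ?thesis unfolding E_def by (rule real_distribution_distr) simp
  qed
  have E_int: "(\<integral>x. f x \<partial>E D) = (\<integral>x. f (exp (- x)) \<partial>D)"
    if "real_distribution D" "f \<in> borel_measurable borel"
    for D and f :: "real \<Rightarrow> 'b :: {banach, second_countable_topology}"
  proof -
    interpret real_distribution D by fact
    show ?thesis unfolding E_def using that by (subst integral_distr) auto
  qed
  have E01: "AE x in E D. x \<in> {0..1}" if "real_distribution D" "AE x in D. 0 \<le> x" for D
  proof -
    interpret real_distribution D by fact
    show ?thesis unfolding E_def using that(2) by (subst AE_distr_iff) auto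
  qed
  have weak: "weak_conv_m (\<lambda>n. E (M n)) (E N)"
  proof (rule weak_conv_m_moments_unit_interval)
    fix k :: nat
    have "exp (- x) ^ k = exp (- (real k * x))" for x :: real
      by (simp add: exp_of_nat_mult[symmetric])
    then show "(\<lambda>n. \<integral>x. x ^ k \<partial>E (M n)) \<longlonglongrightarrow> (\<integral>x. x ^ k \<partial>E N)"
      using laplace[of k] M N by (simp add: E_int)
  qed (use E E01 M N M0 N0 in auto)
  let ?f = "\<lambda>x. iexp (- t * ln x)"
  have "(\<lambda>n. \<integral>x. ?f x \<partial>E (M n)) \<longlonglongrightarrow> (\<integral>x. ?f x \<partial>E N)"
  proof (rule weak_conv_imp_bdd_ae_continuous_conv[OF E E weak])
    interpret N: real_distribution N by fact
    interpret EN: real_distribution "E N" using E N by simp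
    have "{x. \<not> isCont ?f x} \<subseteq> {0}"
      by (auto intro!: continuous_intros isCont_ln)
    moreover have "emeasure (E N) {0} = 0"
      unfolding E_def by (subst emeasure_distr) (auto simp: vimage_def)
    ultimately show "emeasure (E N) {x. \<not> isCont ?f x} = 0"
      by (metis (no_types, lifting) emeasure_eq_0 EN.events_eq_borel borel_singleton sets.empty_sets insert_not_empty subset_singletonD emeasure_empty)
    show "norm (?f x) \<le> 1" for x by simp
  qed (use M N in auto)
  then show ?thesis by (simp add: E_int M N char_def)
qed

section \<open>The chi-squared distribution\<close>

lemma chi2_density_nonneg: "0 \<le> chi2_density k x"
  unfolding chi2_density_def by (cases "k = 0") (auto intro!: mult_nonneg_nonneg divide_nonneg_nonneg less_imp_le[OF Gamma_real_pos])

lemma chi2_density_measurable [measurable]: "chi2_density k \<in> borel_measurable borel"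
  unfolding chi2_density_def[abs_def] by measurable

text \<open>The tilt only changes the rate of the Gamma density from 1/2 to
  \<open>\<beta> = 1 / 2 + c\<close>, so rescaling by \<open>\<beta>\<close> reduces the integral to
  Euler's. The case \<open>c = 0\<close> says that the density has total mass 1.\<close>

lemma nn_integral_chi2_laplace:
  assumes k: "k > 0" and c: "c \<ge> 0"
  shows "(\<integral>\<^sup>+x. ennreal (chi2_density k x * exp (- (c * x))) \<partial>lborel) = ennreal ((1 + 2 * c) powr (- real k / 2))"
proof -
  define a \<beta> where "a = real k / 2" and "\<beta> = 1 / 2 + c"
  have pos: "a > 0" "\<beta> > 0" "Gamma a > 0" using k c by (auto simp: a_def \<beta>_def)
  define g where "g t = indicator {0..} t * t powr (a - 1) / exp t" for t :: real
  have g_nn: "g t \<ge> 0" for t by (simp add: g_def)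
  have [measurable]: "g \<in> borel_measurable borel" unfolding g_def[abs_def] by measurable
  have "ennreal (Gamma a) = (\<integral>\<^sup>+t. ennreal (g t) \<partial>lborel)"
    unfolding g_def by (rule Gamma_conv_nn_integral_real[OF pos(1)])
  also have "\<dots> = ennreal \<beta> * (\<integral>\<^sup>+x. ennreal (g (0 + \<beta> * x)) \<partial>lborel)"
    using pos by (subst nn_integral_real_affine[of _ \<beta> 0]) auto
  finally have Gamma_eq: "ennreal (Gamma a) = ennreal \<beta> * (\<integral>\<^sup>+x. ennreal (g (\<beta> * x)) \<partial>lborel)" by simp
  have "chi2_density k x * exp (- (c * x)) = (\<beta> powr (1 - a) / (2 powr a * Gamma a)) * g (\<beta> * x)" for x
  proof (cases "x > 0")
    case True
    have x: "\<beta> powr (1 - a) * (\<beta> * x) powr (a - 1) = x powr (a - 1)"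
      using True pos by (simp add: powr_mult powr_add[symmetric])
    have "exp (- x / 2) * exp (- (c * x)) = 1 / exp (\<beta> * x)"
      by (simp add: \<beta>_def exp_minus field_simps exp_add[symmetric])
    moreover have "chi2_density k x * exp (- (c * x)) =
        x powr (a - 1) * (exp (- x / 2) * exp (- (c * x))) / (2 powr a * Gamma a)"
      using True by (simp add: chi2_density_def a_def)
    moreover have "g (\<beta> * x) = (\<beta> * x) powr (a - 1) * (1 / exp (\<beta> * x))"
      using True pos by (simp add: g_def)
    ultimately show ?thesis unfolding x[symmetric]
      by (simp only: times_divide_eq_left times_divide_eq_right divide_divide_eq_left mult_ac)
  next
    case False
    with pos show ?thesis by (cases "x = 0") (auto simp: chi2_density_def g_def zero_le_mult_iff)
  qed
  then have "(\<integral>\<^sup>+x. ennreal (chi2_density k x * exp (- (c * x))) \<partial>lborel)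
     = (\<integral>\<^sup>+x. ennreal (\<beta> powr (1 - a) / (2 powr a * Gamma a)) * ennreal (g (\<beta> * x)) \<partial>lborel)"
    using pos g_nn by (simp add: ennreal_mult[symmetric])
  also have "\<dots> = ennreal (\<beta> powr (1 - a) / (2 powr a * Gamma a)) * (\<integral>\<^sup>+x. ennreal (g (\<beta> * x)) \<partial>lborel)"
    by (rule nn_integral_cmult) simp
  also have "\<dots> = ennreal (\<beta> powr (- a) / (2 powr a * Gamma a)) * (ennreal \<beta> * (\<integral>\<^sup>+x. ennreal (g (\<beta> * x)) \<partial>lborel))"
  proof -
    have "\<beta> powr (1 - a) / (2 powr a * Gamma a) = \<beta> powr (- a) / (2 powr a * Gamma a) * \<beta>"
      using pos powr_add[of \<beta> "- a" 1] by simp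
    then show ?thesis using pos by (simp only: ennreal_mult'' less_imp_le mult.assoc)
  qed
  also have "\<dots> = ennreal (\<beta> powr (- a) / (2 powr a))"
    unfolding Gamma_eq[symmetric] using pos order.strict_implies_not_eq[OF pos(3)]
    by (simp add: ennreal_mult[symmetric])
  also have "\<beta> powr (- a) / (2 powr a) = (2 * \<beta>) powr (- a)"
    using pos by (simp add: powr_mult powr_minus divide_inverse mult.commute)
  finally show ?thesis by (simp add: \<beta>_def a_def)
qed

definition chi2_distribution :: "nat \<Rightarrow> real measure" where
  "chi2_distribution k = density lborel (chi2_density k)"

lemma real_distribution_chi2:
  assumes "k > 0" shows "real_distribution (chi2_distribution k)"
proof -
  have "emeasure (chi2_distribution k) UNIV = 1"
    using nn_integral_chi2_laplace[OF assms, of 0] by (simp add: chi2_distribution_def emeasure_density)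
  then show ?thesis
    by (auto simp: real_distribution_def real_distribution_axioms_def chi2_distribution_def intro!: prob_spaceI)
qed

lemma AE_chi2_nonneg: "AE x in chi2_distribution k. 0 \<le> x"
  unfolding chi2_distribution_def by (subst AE_density) (auto simp: chi2_density_def)

lemma integral_chi2_laplace:
  assumes "k > 0" "c \<ge> 0"
  shows "(\<integral>x. exp (- (c * x)) \<partial>chi2_distribution k) = (1 + 2 * c) powr (- real k / 2)"
proof -
  have "(\<integral>x. exp (- (c * x)) \<partial>chi2_distribution k) = (\<integral>x. chi2_density k x * exp (- (c * x)) \<partial>lborel)"
    unfolding chi2_distribution_def by (subst integral_density) (auto simp: chi2_density_nonneg)
  also have "\<dots> = (1 + 2 * c) powr (- real k / 2)"
    using nn_integral_chi2_laplace[OF assms] chi2_density_nonneg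
    by (intro integral_eq_nn_integral[THEN trans]) (auto simp: enn2real_ennreal)
  finally show ?thesis .
qed

section \<open>Gaussian integrals\<close>

text \<open>Completing the square: the integrand is a multiple of the normal density with mean
  \<open>b / (1 - a)\<close> and variance \<open>1 / (1 - a)\<close>.\<close>

lemma nn_integral_std_normal_exp:
  assumes "a < 1"
  shows "(\<integral>\<^sup>+z. ennreal (exp (a * z\<^sup>2 / 2 + b * z)) \<partial>std_normal_distribution) =
    ennreal ((1 - a) powr (- 1 / 2) * exp (b\<^sup>2 / (2 * (1 - a))))"
proof -
  define s where "s = 1 / sqrt (1 - a)"
  have s: "s > 0" "s\<^sup>2 = 1 / (1 - a)" using assms by (auto simp: s_def power_divide)
  have eq: "std_normal_density z * exp (a * z\<^sup>2 / 2 + b * z) =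
      s * exp (b\<^sup>2 / (2 * (1 - a))) * normal_density (b / (1 - a)) s z" for z
  proof -
    have "- z\<^sup>2 / 2 + (a * z\<^sup>2 / 2 + b * z) =
        b\<^sup>2 / (2 * (1 - a)) + - (z - b / (1 - a))\<^sup>2 / (2 * s\<^sup>2)"
      unfolding s(2) using assms by (simp add: power2_eq_square divide_simps) algebra
    then have e: "exp (- z\<^sup>2 / 2) * exp (a * z\<^sup>2 / 2 + b * z) =
        exp (b\<^sup>2 / (2 * (1 - a))) * exp (- (z - b / (1 - a))\<^sup>2 / (2 * s\<^sup>2))"
      by (simp only: exp_add[symmetric])
    have q: "1 / sqrt (2 * pi) = s * (1 / sqrt (2 * pi * s\<^sup>2))"
      using s(1) by (simp add: real_sqrt_mult)
    have "std_normal_density z * exp (a * z\<^sup>2 / 2 + b * z) =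
        1 / sqrt (2 * pi) * (exp (- z\<^sup>2 / 2) * exp (a * z\<^sup>2 / 2 + b * z))"
      by (simp add: std_normal_density_def)
    also have "\<dots> = s * exp (b\<^sup>2 / (2 * (1 - a))) * normal_density (b / (1 - a)) s z"
      unfolding e q normal_density_def by (simp only: mult_ac)
    finally show ?thesis .
  qed
  have "(\<integral>\<^sup>+z. ennreal (exp (a * z\<^sup>2 / 2 + b * z)) \<partial>std_normal_distribution) =
      (\<integral>\<^sup>+z. ennreal (std_normal_density z * exp (a * z\<^sup>2 / 2 + b * z)) \<partial>lborel)"
    by (subst nn_integral_density) (auto simp: ennreal_mult[symmetric])
  also have "\<dots> = (\<integral>\<^sup>+z. ennreal (s * exp (b\<^sup>2 / (2 * (1 - a)))) * ennreal (normal_density (b / (1 - a)) s z) \<partial>lborel)"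
    unfolding eq using s by (simp add: ennreal_mult)
  also have "\<dots> = ennreal (s * exp (b\<^sup>2 / (2 * (1 - a)))) * (\<integral>\<^sup>+z. ennreal (normal_density (b / (1 - a)) s z) \<partial>lborel)"
    by (rule nn_integral_cmult) simp
  also have "(\<integral>\<^sup>+z. ennreal (normal_density (b / (1 - a)) s z) \<partial>lborel) = 1"
    using prob_space.emeasure_space_1[OF prob_space_normal_density[OF s(1), of "b / (1 - a)"]]
    by (simp add: emeasure_density)
  finally show ?thesis using assms
    by (simp add: s_def powr_minus_divide powr_half_sqrt)
qed

abbreviation std_normals :: "'c set \<Rightarrow> ('c \<Rightarrow> real) measure" where
  "std_normals C \<equiv> PiM C (\<lambda>_. std_normal_distribution)"

lemma prob_space_std_normal: "prob_space std_normal_distribution"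
  using real_dist_normal_dist by (simp add: real_distribution_def)

lemma prob_space_std_normals: "prob_space (std_normals C)"
  by (intro prob_space_PiM prob_space_std_normal)

lemma product_sigma_finite_std_normal: "product_sigma_finite (\<lambda>_. std_normal_distribution)"
proof -
  interpret prob_space std_normal_distribution by (rule prob_space_std_normal)
  show ?thesis by standard
qed

lemma component_std_normals_measurable [measurable]:
  "c \<in> C \<Longrightarrow> (\<lambda>g. g c) \<in> borel_measurable (std_normals C)"
  using measurable_component_singleton[of c C "\<lambda>_. std_normal_distribution"] by simp

lemma nn_integral_std_normals_sample_variance:
  fixes C :: "'c set"
  assumes C: "finite C" "C \<noteq> {}" and b: "b \<ge> 0"
  shows "(\<integral>\<^sup>+g. ennreal (exp (- b / 2 * (\<Sum>c\<in>C. (g c - (\<Sum>c\<in>C. g c) / card C)\<^sup>2))) \<partial>std_normals C)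
    = ennreal ((1 + b) powr (- real (card C - 1) / 2))"
proof -
  interpret product_sigma_finite "\<lambda>_ :: 'c. std_normal_distribution"
    by (rule product_sigma_finite_std_normal)
  interpret G: prob_space "std_normals C" by (rule prob_space_std_normals)
  interpret Z: prob_space std_normal_distribution by (rule prob_space_std_normal)
  interpret pair_sigma_finite "std_normals C" std_normal_distribution by standard
  define l where "l = real (card C)"
  define d where "d = sqrt (b / l)"
  \<comment> \<open>The square of the sum in the exponent is linearised by an auxiliary Gaussian \<open>z\<close>, which decouples
    the coordinates of \<open>g\<close>.\<close>
  have l: "l > 0" using C by (auto simp: l_def card_gt_0_iff)
  have d: "d\<^sup>2 = b / l" using b l by (simp add: d_def)
  let ?f = "\<lambda>g z. \<Prod>c\<in>C. ennreal (exp ((- b) * (g c)\<^sup>2 / 2 + (d * z) * g c))"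
  have [measurable]: "(\<lambda>(g, z). ?f g z) \<in> borel_measurable (std_normals C \<Otimes>\<^sub>M std_normal_distribution)"
    using C by measurable
  have inner: "ennreal (exp (- b / 2 * (\<Sum>c\<in>C. (g c - (\<Sum>c\<in>C. g c) / card C)\<^sup>2))) =
      (\<integral>\<^sup>+z. ?f g z \<partial>std_normal_distribution)" for g :: "'c \<Rightarrow> real"
  proof -
    define S where "S = (\<Sum>c\<in>C. g c)"
    have "(\<Sum>c\<in>C. (g c - a)\<^sup>2) = (\<Sum>c\<in>C. (g c)\<^sup>2) - 2 * a * S + l * a\<^sup>2" for a
    proof -
      have "(g c - a)\<^sup>2 = (g c)\<^sup>2 - 2 * a * g c + a\<^sup>2" for c by (simp add: power2_diff)
      then show ?thesis
        by (simp only: sum.distrib sum_subtractf sum_distrib_left[symmetric] sum_constant S_def l_def)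
    qed
    then have "(\<Sum>c\<in>C. (g c - S / l)\<^sup>2) = (\<Sum>c\<in>C. (g c)\<^sup>2) - 2 * (S / l) * S + l * (S / l)\<^sup>2" .
    also have "\<dots> = (\<Sum>c\<in>C. (g c)\<^sup>2) - S\<^sup>2 / l"
      using l by (simp add: power2_eq_square field_simps)
    finally have sq: "(\<Sum>c\<in>C. (g c - S / l)\<^sup>2) = (\<Sum>c\<in>C. (g c)\<^sup>2) - S\<^sup>2 / l" .
    have var: "- b / 2 * (\<Sum>c\<in>C. (g c - S / l)\<^sup>2) = - b / 2 * (\<Sum>c\<in>C. (g c)\<^sup>2) + (d * S)\<^sup>2 / 2"
      unfolding sq power_mult_distrib d by (simp add: algebra_simps)
    have "?f g z = ennreal (exp (- b / 2 * (\<Sum>c\<in>C. (g c)\<^sup>2))) * ennreal (exp (0 * z\<^sup>2 / 2 + (d * S) * z))" for z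
      using C by (simp add: prod_ennreal exp_sum[symmetric] ennreal_mult[symmetric] exp_add[symmetric]
          sum.distrib sum_subtractf sum_distrib_left sum_distrib_right sum_negf sum_divide_distrib S_def mult_ac)
    then have "(\<integral>\<^sup>+z. ?f g z \<partial>std_normal_distribution) =
       ennreal (exp (- b / 2 * (\<Sum>c\<in>C. (g c)\<^sup>2))) * (\<integral>\<^sup>+z. ennreal (exp (0 * z\<^sup>2 / 2 + (d * S) * z)) \<partial>std_normal_distribution)"
      by (simp only:) (rule nn_integral_cmult, simp)
    also have "\<dots> = ennreal (exp (- b / 2 * (\<Sum>c\<in>C. (g c)\<^sup>2)) * exp ((d * S)\<^sup>2 / 2))"
      by (subst nn_integral_std_normal_exp) (simp_all add: ennreal_mult)
    finally show ?thesis unfolding exp_add[symmetric] var[symmetric] by (simp add: S_def l_def)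
  qed
  have "(\<integral>\<^sup>+g. (\<integral>\<^sup>+z. ?f g z \<partial>std_normal_distribution) \<partial>std_normals C) =
     (\<integral>\<^sup>+z. (\<integral>\<^sup>+g. ?f g z \<partial>std_normals C) \<partial>std_normal_distribution)"
    by (rule Fubini'[symmetric]) measurable
  also have "\<dots> = (\<integral>\<^sup>+z. (\<Prod>c\<in>C. \<integral>\<^sup>+x. ennreal (exp ((- b) * x\<^sup>2 / 2 + (d * z) * x)) \<partial>std_normal_distribution) \<partial>std_normal_distribution)"
    using C by (subst product_nn_integral_prod) auto
  \<comment> \<open>Given \<open>z\<close>, each coordinate is a Gaussian integral with quadratic
    coefficient \<open>- b\<close>. The \<open>card C\<close> equal factors combine into a Gaussian
    in \<open>z\<close> with coefficient \<open>l * d\<^sup>2 / (1 + b) = b / (1 + b)\<close>, which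
    is below 1, so the same formula applies once more.\<close>
  also have "\<dots> = (\<integral>\<^sup>+z. (\<Prod>c\<in>C. ennreal ((1 + b) powr (- 1 / 2) * exp ((d * z)\<^sup>2 / (2 * (1 + b))))) \<partial>std_normal_distribution)"
    using b by (subst nn_integral_std_normal_exp) auto
  also have "\<dots> = (\<integral>\<^sup>+z. ennreal ((1 + b) powr (- l / 2)) * ennreal (exp ((b / (1 + b)) * z\<^sup>2 / 2 + 0 * z)) \<partial>std_normal_distribution)"
  proof (rule nn_integral_cong)
    fix z :: real
    have "((1 + b) powr (- 1 / 2)) ^ card C = (1 + b) powr (- l / 2)"
      using b by (simp add: powr_realpow[symmetric] powr_powr l_def)
    moreover have "exp ((d * z)\<^sup>2 / (2 * (1 + b))) ^ card C = exp ((b / (1 + b)) * z\<^sup>2 / 2 + 0 * z)"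
      unfolding exp_of_nat_mult[symmetric] l_def[symmetric] power_mult_distrib d
      using l by simp
    ultimately show "(\<Prod>c\<in>C. ennreal ((1 + b) powr (- 1 / 2) * exp ((d * z)\<^sup>2 / (2 * (1 + b))))) =
      ennreal ((1 + b) powr (- l / 2)) * ennreal (exp ((b / (1 + b)) * z\<^sup>2 / 2 + 0 * z))"
      by (simp add: ennreal_power power_mult_distrib ennreal_mult)
  qed
  \<comment> \<open>The integral over \<open>z\<close> is \<open>(1 + b) powr (1 / 2)\<close>. It
    gives back half a unit of the exponent: the degree of freedom lost by centring at the sample
    mean.\<close>
  also have "\<dots> = ennreal ((1 + b) powr (- l / 2)) * ennreal ((1 - b / (1 + b)) powr (- 1 / 2) * exp (0\<^sup>2 / (2 * (1 - b / (1 + b)))))"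
    using b by (subst nn_integral_cmult, simp, subst nn_integral_std_normal_exp) simp_all
  also have "1 - b / (1 + b) = (1 + b) powr (- 1)"
    using b by (simp add: powr_minus_divide field_simps)
  also have "ennreal ((1 + b) powr (- l / 2)) * ennreal (((1 + b) powr (- 1)) powr (- 1 / 2) * exp (0\<^sup>2 / (2 * (1 + b) powr (- 1)))) =
     ennreal ((1 + b) powr (- l / 2 + 1 / 2))"
    using b by (simp only: powr_powr powr_add) (simp add: ennreal_mult)
  also have "- l / 2 + 1 / 2 = - real (card C - 1) / 2"
    using l by (simp add: l_def of_nat_diff card_gt_0_iff Suc_le_eq field_simps)
  finally show ?thesis by (simp only: inner)
qed

lemma integral_std_normals_sample_variance:
  fixes C :: "'c set"
  assumes "finite C" "C \<noteq> {}" and "b \<ge> 0"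
  shows "(\<integral>g. exp (- b / 2 * (\<Sum>c\<in>C. (g c - (\<Sum>c\<in>C. g c) / card C)\<^sup>2)) \<partial>std_normals C)
    = (1 + b) powr (- real (card C - 1) / 2)"
  using nn_integral_std_normals_sample_variance[OF assms] assms
  by (intro integral_eq_nn_integral[THEN trans]) (auto simp del: sets_PiM)

section \<open>Pearson's chi-squared statistic\<close>

text \<open>The sum of (observed - expected)^2 / expected, where every cell has expected count
  \<open>card J / card C\<close>. For empty \<open>J\<close> the division by zero makes it
  0.\<close>

definition pearson_stat :: "'j set \<Rightarrow> 'c set \<Rightarrow> ('j \<Rightarrow> 'c) \<Rightarrow> real" where
  "pearson_stat J C h =
     card C / card J * (\<Sum>c\<in>C. (real (card {j \<in> J. h j = c}) - card J / card C)\<^sup>2)"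

lemma pearson_stat_nonneg: "0 \<le> pearson_stat J C h"
  unfolding pearson_stat_def by (intro mult_nonneg_nonneg sum_nonneg) auto

lemma sum_card_fibres:
  fixes f :: "'c \<Rightarrow> real"
  assumes "finite J" "finite C" "h ` J \<subseteq> C"
  shows "(\<Sum>c\<in>C. real (card {j \<in> J. h j = c}) * f c) = (\<Sum>j\<in>J. f (h j))"
proof -
  have "(\<Sum>c\<in>C. real (card {j \<in> J. h j = c}) * f c) = (\<Sum>c\<in>C. \<Sum>j\<in>{j \<in> J. h j = c}. f (h j))"
    by (intro sum.cong) auto
  also have "\<dots> = (\<Sum>j\<in>J. f (h j))" using assms by (rule sum.group)
  finally show ?thesis .
qed

text \<open>Using the normal characteristic function in every cell replaces the squares of the
  counts by linear terms. Summing \<open>g\<close> against the counts is summing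
  \<open>g (h j)\<close> over \<open>j\<close>, and centring the counts amounts to centring
  \<open>g\<close>; hence the integrand is a product over \<open>j\<close>.\<close>

lemma exp_pearson_stat_eq_integral:
  fixes h :: "'j \<Rightarrow> 'c" and k :: real
  assumes fin: "finite J" "finite C" "C \<noteq> {}" and h: "h ` J \<subseteq> C" and k: "k \<ge> 0"
  shows "complex_of_real (exp (- (k * pearson_stat J C h))) =
    (\<integral>g. (\<Prod>j\<in>J. iexp (sqrt (2 * k * card C) / sqrt (card J) * (g (h j) - (\<Sum>c\<in>C. g c) / card C)))
      \<partial>std_normals C)"
proof -
  interpret product_sigma_finite "\<lambda>_ :: 'c. std_normal_distribution"
    by (rule product_sigma_finite_std_normal)
  interpret Z: prob_space std_normal_distribution by (rule prob_space_std_normal)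
  define N where "N c = real (card {j \<in> J. h j = c})" for c
  \<comment> \<open>Solved from the requirement that half the sum of the
    \<open>(y c)\<^sup>2\<close> be \<open>k * pearson_stat J C h\<close>.\<close>
  define \<theta> where "\<theta> = sqrt (2 * k * card C) / sqrt (card J)"
  define y where "y c = \<theta> * (N c - card J / card C)" for c
  have \<theta>: "\<theta>\<^sup>2 = 2 * (k * (card C / card J))"
    using k by (simp add: \<theta>_def power_divide)
  have prod_eq: "(\<Prod>c\<in>C. iexp (y c * g c)) = (\<Prod>j\<in>J. iexp (\<theta> * (g (h j) - (\<Sum>c\<in>C. g c) / card C)))" for g
  proof -
    have "(\<Sum>c\<in>C. y c * g c) = \<theta> * ((\<Sum>c\<in>C. N c * g c) - (\<Sum>c\<in>C. g c) * (card J / card C))"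
    proof -
      have "y c * g c = \<theta> * (N c * g c - g c * (card J / card C))" for c
        by (simp add: y_def algebra_simps)
      then show ?thesis
        by (simp only: sum_distrib_left[symmetric] sum_distrib_right[symmetric] sum_subtractf)
    qed
    also have "(\<Sum>c\<in>C. N c * g c) = (\<Sum>j\<in>J. g (h j))"
      unfolding N_def using fin h by (intro sum_card_fibres) auto
    also have "\<theta> * ((\<Sum>j\<in>J. g (h j)) - (\<Sum>c\<in>C. g c) * (card J / card C)) =
        (\<Sum>j\<in>J. \<theta> * (g (h j) - (\<Sum>c\<in>C. g c) / card C))"
      by (simp add: sum_distrib_left[symmetric] sum_subtractf)
    finally show ?thesis
      using fin by (simp only: exp_sum[symmetric] sum_distrib_left[symmetric] of_real_sum[symmetric])
  qed
  have "- (k * pearson_stat J C h) = (\<Sum>c\<in>C. - (y c)\<^sup>2 / 2)"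
    by (simp add: pearson_stat_def N_def y_def power_mult_distrib \<theta> sum_distrib_left sum_negf mult.assoc)
  then have "complex_of_real (exp (- (k * pearson_stat J C h))) =
      (\<Prod>c\<in>C. of_real (exp (- (y c)\<^sup>2 / 2)))"
    using fin by (simp only: exp_sum of_real_prod)
  also have "\<dots> = (\<Prod>c\<in>C. \<integral>x. iexp (y c * x) \<partial>std_normal_distribution)"
    by (simp only: char_std_normal_distribution[THEN fun_cong, symmetric] char_def)
  also have "\<dots> = (\<integral>g. (\<Prod>c\<in>C. iexp (y c * g c)) \<partial>std_normals C)"
    using fin by (subst product_integral_prod) (auto intro!: Z.integrable_const_bound[of _ 1])
  also have "\<dots> = (\<integral>g. (\<Prod>j\<in>J. iexp (\<theta> * (g (h j) - (\<Sum>c\<in>C. g c) / card C))) \<partial>std_normals C)"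
    by (simp only: prod_eq)
  finally show ?thesis by (simp only: \<theta>_def)
qed

lemma integral_pmf_of_set_PiE:
  fixes f :: "('j \<Rightarrow> 'c) \<Rightarrow> 'b :: {real_normed_field, banach, second_countable_topology}"
  assumes "finite J" "finite C" "C \<noteq> {}"
  shows "(\<integral>h. f h \<partial>measure_pmf (pmf_of_set (J \<rightarrow>\<^sub>E C))) = (\<Sum>h\<in>J \<rightarrow>\<^sub>E C. f h) / of_nat (card C) ^ card J"
proof -
  have fin: "finite (J \<rightarrow>\<^sub>E C)" "J \<rightarrow>\<^sub>E C \<noteq> {}" using assms by (auto simp: finite_PiE PiE_eq_empty_iff)
  then have "(\<integral>h. f h \<partial>measure_pmf (pmf_of_set (J \<rightarrow>\<^sub>E C))) = (\<Sum>h\<in>J \<rightarrow>\<^sub>E C. (1 / card (J \<rightarrow>\<^sub>E C)) *\<^sub>R f h)"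
    by (subst integral_measure_pmf[of "J \<rightarrow>\<^sub>E C"]) auto
  also have "card (J \<rightarrow>\<^sub>E C) = card C ^ card J" using assms by (simp add: card_PiE)
  finally show ?thesis by (simp add: scaleR_conv_of_real sum_divide_distrib)
qed

text \<open>For frozen \<open>g\<close> the labels are independent and uniform, so averaging the
  product over all \<open>h\<close> yields the \<open>card J\<close>-th power of the average over a
  single label.\<close>

lemma pearson_laplace_eq_integral:
  fixes C :: "'c set" and J :: "'j set" and k :: real
  assumes fin: "finite J" "finite C" "C \<noteq> {}" and k: "k \<ge> 0"
  shows "(\<integral>h. complex_of_real (exp (- (k * pearson_stat J C h))) \<partial>measure_pmf (pmf_of_set (J \<rightarrow>\<^sub>E C))) =
    (\<integral>g. ((\<Sum>c\<in>C. iexp (sqrt (2 * k * card C) / sqrt (card J) * (g c - (\<Sum>c\<in>C. g c) / card C)))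
       / card C) ^ card J \<partial>std_normals C)"
proof -
  interpret G: prob_space "std_normals C" by (rule prob_space_std_normals)
  define F where "F g c = iexp (sqrt (2 * k * card C) / sqrt (card J) * (g c - (\<Sum>c\<in>C. g c) / card C))"
    for g :: "'c \<Rightarrow> real" and c
  have int: "integrable (std_normals C) (\<lambda>g. \<Prod>j\<in>J. F g (h j))" if "h \<in> J \<rightarrow>\<^sub>E C" for h
  proof (intro G.integrable_const_bound[of _ 1] AE_I2)
    show "(\<lambda>g. \<Prod>j\<in>J. F g (h j)) \<in> borel_measurable (std_normals C)"
    proof (rule borel_measurable_prod)
      fix j assume "j \<in> J"
      then have "h j \<in> C" using that by auto
      then show "(\<lambda>g. F g (h j)) \<in> borel_measurable (std_normals C)"
        unfolding F_def by measurable
    qed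
    show "norm (\<Prod>j\<in>J. F g (h j)) \<le> 1" for g
      unfolding prod_norm[symmetric] by (intro prod_le_1) (simp add: F_def)
  qed
  have "(\<integral>h. complex_of_real (exp (- (k * pearson_stat J C h))) \<partial>measure_pmf (pmf_of_set (J \<rightarrow>\<^sub>E C))) =
     (\<Sum>h\<in>J \<rightarrow>\<^sub>E C. complex_of_real (exp (- (k * pearson_stat J C h)))) / of_nat (card C) ^ card J"
    using fin by (rule integral_pmf_of_set_PiE)
  also have "(\<Sum>h\<in>J \<rightarrow>\<^sub>E C. complex_of_real (exp (- (k * pearson_stat J C h)))) =
      (\<Sum>h\<in>J \<rightarrow>\<^sub>E C. \<integral>g. (\<Prod>j\<in>J. F g (h j)) \<partial>std_normals C)"
    unfolding F_def by (intro sum.cong exp_pearson_stat_eq_integral fin k) auto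
  also have "\<dots> = (\<integral>g. (\<Sum>h\<in>J \<rightarrow>\<^sub>E C. \<Prod>j\<in>J. F g (h j)) \<partial>std_normals C)"
    using int by (rule Bochner_Integration.integral_sum[symmetric])
  also have "\<dots> = (\<integral>g. (\<Sum>c\<in>C. F g c) ^ card J \<partial>std_normals C)"
    using fin by (subst prod_sum_PiE[symmetric]) auto
  also have "(\<integral>g. (\<Sum>c\<in>C. F g c) ^ card J \<partial>std_normals C) / of_nat (card C) ^ card J =
      (\<integral>g. ((\<Sum>c\<in>C. F g c) / card C) ^ card J \<partial>std_normals C)"
    by (simp add: power_divide)
  finally show ?thesis by (simp only: F_def)
qed

text \<open>With \<open>g\<close> frozen this is the one-dimensional central limit theorem for the
  uniform law on the values \<open>g c - a\<close>, which has mean 0 by the choice of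
  \<open>a\<close>.\<close>

lemma mean_iexp_power_tendsto:
  fixes C :: "'c set" and g :: "'c \<Rightarrow> real"
  assumes C: "finite C" "C \<noteq> {}"
  defines "a \<equiv> (\<Sum>c\<in>C. g c) / card C"
  shows "(\<lambda>m. ((\<Sum>c\<in>C. iexp (s / sqrt (real m) * (g c - a))) / card C) ^ m)
    \<longlonglongrightarrow> of_real (exp (- (s\<^sup>2 * ((\<Sum>c\<in>C. (g c - a)\<^sup>2) / card C) / 2)))"
proof -
  define D where "D = distr (measure_pmf (pmf_of_set C)) borel (\<lambda>c. g c - a)"
  interpret D: real_distribution D unfolding D_def
    by (rule prob_space.real_distribution_distr[OF prob_space_measure_pmf]) simp
  have int_D: "(\<integral>x. f x \<partial>D) = (\<Sum>c\<in>C. f (g c - a)) / of_nat (card C)"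
    if [measurable]: "f \<in> borel_measurable borel"
    for f :: "real \<Rightarrow> 'b :: {real_normed_field, banach, second_countable_topology}"
  proof -
    have "(\<integral>x. f x \<partial>D) = (\<integral>c. f (g c - a) \<partial>measure_pmf (pmf_of_set C))"
      unfolding D_def by (subst integral_distr) auto
    also have "\<dots> = (\<Sum>c\<in>C. (1 / card C) *\<^sub>R f (g c - a))"
      using C by (subst integral_measure_pmf[of C]) auto
    finally show ?thesis by (simp add: scaleR_conv_of_real sum_divide_distrib)
  qed
  have integrable_D: "integrable D f" if [measurable]: "f \<in> borel_measurable borel" for f :: "real \<Rightarrow> real"
  proof -
    have "finite (set_pmf (pmf_of_set C))" using C by simp
    then have *: "integrable (measure_pmf (pmf_of_set C)) (\<lambda>c. f (g c - a))"
      by (rule integrable_measure_pmf_finite)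
    show ?thesis unfolding D_def by (rule integrable_distr_eq[THEN iffD2, OF _ that *]) simp
  qed
  have mean: "(\<integral>x. x \<partial>D) = 0"
    using C by (subst int_D) (simp_all add: sum_subtractf a_def)
  have var: "(\<integral>x. x\<^sup>2 \<partial>D) = (\<Sum>c\<in>C. (g c - a)\<^sup>2) / card C"
    by (subst int_D) simp_all
  have char_D: "char D (s / sqrt (real m)) = (\<Sum>c\<in>C. iexp (s / sqrt (real m) * (g c - a))) / card C" for m
    unfolding char_def by (subst int_D) simp_all
  show ?thesis
    unfolding char_D[symmetric]
    by (rule D.char_scaled_power_tendsto) (simp_all add: mean var integrable_D)
qed

lemma pearson_laplace_tendsto:
  fixes C :: "'c set" and k :: real
  assumes C: "finite C" "C \<noteq> {}" and k: "k \<ge> 0"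
  shows "(\<lambda>m::nat. \<integral>h. exp (- (k * pearson_stat {1..m} C h)) \<partial>measure_pmf (pmf_of_set ({1..m} \<rightarrow>\<^sub>E C)))
    \<longlonglongrightarrow> (1 + 2 * k) powr (- real (card C - 1) / 2)"
proof -
  interpret G: prob_space "std_normals C" by (rule prob_space_std_normals)
  let ?F = "\<lambda>m g. ((\<Sum>c\<in>C. iexp (sqrt (2 * k * card C) / sqrt (real m) * (g c - (\<Sum>c\<in>C. g c) / card C)))
       / card C) ^ m"
  let ?L = "\<lambda>g. complex_of_real (exp (- (2 * k) / 2 * (\<Sum>c\<in>C. (g c - (\<Sum>c\<in>C. g c) / card C)\<^sup>2)))"
  have "(\<lambda>m. \<integral>g. ?F m g \<partial>std_normals C) \<longlonglongrightarrow> (\<integral>g. ?L g \<partial>std_normals C)"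
  proof (rule integral_dominated_convergence[where w = "\<lambda>_. 1"])
    show "?L \<in> borel_measurable (std_normals C)"
      using C by measurable
    show "?F m \<in> borel_measurable (std_normals C)" for m
      using C by measurable
    show "AE g in std_normals C. (\<lambda>m. ?F m g) \<longlonglongrightarrow> ?L g"
    proof (rule AE_I2)
      fix g :: "'c \<Rightarrow> real"
      \<comment> \<open>With \<open>s\<^sup>2 = 2 * k * card C\<close> the divisor
        \<open>card C\<close> of the variance cancels, leaving the sample variance integral with
        \<open>b = 2 * k\<close>.\<close>
      have "- ((sqrt (2 * k * card C))\<^sup>2 * ((\<Sum>c\<in>C. (g c - (\<Sum>c\<in>C. g c) / card C)\<^sup>2) / card C) / 2) =
         - (2 * k) / 2 * (\<Sum>c\<in>C. (g c - (\<Sum>c\<in>C. g c) / card C)\<^sup>2)"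
        using C k by simp
      then show "(\<lambda>m. ?F m g) \<longlonglongrightarrow> ?L g"
        using mean_iexp_power_tendsto[OF C, where g=g and s="sqrt (2 * k * card C)"] by (simp only:)
    qed
    show "AE g in std_normals C. norm (?F m g) \<le> 1" for m
    proof (rule AE_I2)
      fix g :: "'c \<Rightarrow> real"
      have "norm (\<Sum>c\<in>C. iexp (sqrt (2 * k * card C) / sqrt (real m) * (g c - (\<Sum>c\<in>C. g c) / card C))) \<le> (\<Sum>c\<in>C. 1)"
        by (rule sum_norm_le) simp
      then show "norm (?F m g) \<le> 1"
        using C unfolding norm_power norm_divide
        by (intro power_le_one) (auto simp: divide_le_eq card_gt_0_iff)
    qed
  qed auto
  moreover have "(\<integral>g. ?F m g \<partial>std_normals C) =
      of_real (\<integral>h. exp (- (k * pearson_stat {1..m} C h)) \<partial>measure_pmf (pmf_of_set ({1..m} \<rightarrow>\<^sub>E C)))" for m :: nat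
    using pearson_laplace_eq_integral[where J="{1..m}" and C=C and k=k] C k by simp
  moreover have "(\<integral>g. ?L g \<partial>std_normals C) = of_real ((1 + 2 * k) powr (- real (card C - 1) / 2))"
    using integral_std_normals_sample_variance[OF C, of "2 * k"] k
    unfolding integral_complex_of_real by (intro arg_cong[where f=of_real]) auto
  ultimately show ?thesis by (simp only: tendsto_of_real_iff)
qed

text \<open>Two evaluations meet here: the Gaussian integral with \<open>b = 2 * k\<close> and the
  Laplace transform of the chi-squared density give the same power of
  \<open>1 + 2 * k\<close>.\<close>

theorem pearson_char_tendsto:
  assumes C: "finite C" "card C \<ge> 2"
  shows "(\<lambda>m::nat. \<integral>h. iexp (t * pearson_stat {1..m} C h) \<partial>measure_pmf (pmf_of_set ({1..m} \<rightarrow>\<^sub>E C)))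
    \<longlonglongrightarrow> char (chi2_distribution (card C - 1)) t"
proof -
  define D where "D m = distr (measure_pmf (pmf_of_set ({1..m} \<rightarrow>\<^sub>E C))) borel (pearson_stat {1..m} C)" for m :: nat
  have C': "C \<noteq> {}" using C by auto
  have "(\<lambda>m. char (D m) t) \<longlonglongrightarrow> char (chi2_distribution (card C - 1)) t"
  proof (rule char_tendsto_laplace)
    show "real_distribution (D m)" for m
      unfolding D_def by (rule prob_space.real_distribution_distr[OF prob_space_measure_pmf]) simp
    show "real_distribution (chi2_distribution (card C - 1))"
      using C by (intro real_distribution_chi2) auto
    show "AE x in D m. 0 \<le> x" for m
      unfolding D_def by (subst AE_distr_iff) (auto simp: pearson_stat_nonneg)
    show "(\<lambda>m. \<integral>x. exp (- (real k * x)) \<partial>D m)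
        \<longlonglongrightarrow> (\<integral>x. exp (- (real k * x)) \<partial>chi2_distribution (card C - 1))" for k :: nat
      using pearson_laplace_tendsto[of C "real k"] C C'
      by (simp add: D_def integral_distr integral_chi2_laplace)
  qed (rule AE_chi2_nonneg)
  then show ?thesis by (simp add: D_def char_def integral_distr)
qed

section \<open>Matching pairs and Pearson's statistic\<close>

abbreviation index_pairs :: "nat \<Rightarrow> (nat \<times> nat) set" where
  "index_pairs m \<equiv> {(i, j). 1 \<le> i \<and> i < j \<and> j \<le> m}"

lemma finite_index_pairs: "finite (index_pairs m)"
  by (rule finite_subset[of _ "{1..m} \<times> {1..m}"]) auto

lemma card_index_pairs: "card (index_pairs m) = m choose 2"
  using bij_betw_same_card[OF bij_betw_kidx[of m]] by simp

definition matches :: "nat \<Rightarrow> (nat \<Rightarrow> 'c) \<Rightarrow> nat" where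
  "matches m h = card {(i, j) \<in> index_pairs m. h i = h j}"

lemma matches_le: "matches m h \<le> m choose 2"
  unfolding matches_def card_index_pairs[symmetric]
  by (intro card_mono finite_index_pairs) auto

lemma real_choose_2: "real (m choose 2) = real m * (real m - 1) / 2"
  by (cases m) (simp_all add: choose_two real_of_nat_div algebra_simps)

text \<open>The sum of squares counts ordered pairs of positions with equal labels: the diagonal
  once, every matching pair \<open>i < j\<close> twice.\<close>

lemma sum_square_card_fibres:
  assumes "finite C" "h ` {1..m} \<subseteq> C"
  shows "(\<Sum>c\<in>C. (real (card {j \<in> {1..m}. h j = c}))\<^sup>2) = real m + 2 * real (matches m h)"
proof -
  let ?P = "{(i, j) \<in> index_pairs m. h i = h j}"
  let ?D = "(\<lambda>i. (i, i)) ` {1..m}"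
  have fin: "finite ?P" by (rule finite_subset[OF _ finite_index_pairs]) auto
  have "(\<Sum>c\<in>C. (real (card {j \<in> {1..m}. h j = c}))\<^sup>2) = (\<Sum>j\<in>{1..m}. real (card {i \<in> {1..m}. h i = h j}))"
    unfolding power2_eq_square using assms by (intro sum_card_fibres) auto
  also have "\<dots> = real (card (SIGMA j:{1..m}. {i \<in> {1..m}. h i = h j}))" by simp
  also have "(SIGMA j:{1..m}. {i \<in> {1..m}. h i = h j}) = ?D \<union> (?P \<union> prod.swap ` ?P)"
  proof (rule set_eqI, clarify)
    fix a b
    show "((a, b) \<in> (SIGMA j:{1..m}. {i \<in> {1..m}. h i = h j})) = ((a, b) \<in> ?D \<union> (?P \<union> prod.swap ` ?P))"
      by (cases a b rule: linorder_cases) (auto simp: image_iff)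
  qed
  also have "card \<dots> = card ?D + (card ?P + card (prod.swap ` ?P))"
    using fin by (subst card_Un_disjoint, force, force, force, subst card_Un_disjoint) auto
  also have "card ?D = m" by (subst card_image) (auto simp: inj_on_def)
  also have "card (prod.swap ` ?P) = card ?P" by (intro card_image) auto
  finally show ?thesis by (simp add: matches_def)
qed

text \<open>Both sides are affine in the sum of squared counts. The factor
  \<open>m / (2 * card C)\<close> is comparable with the square root of \<open>m choose 2\<close>,
  which is why the match count stays visible after standardisation.\<close>

lemma matches_eq_pearson_stat:
  assumes C: "finite C" "C \<noteq> {}" and m: "m \<ge> 1" and h: "h ` {1..m} \<subseteq> C"
  shows "real (matches m h) - real (m choose 2) / card C =
    real m / (2 * real (card C)) * (pearson_stat {1..m} C h - (real (card C) - 1))"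
proof -
  define l where "l = real (card C)"
  define N where "N c = real (card {j \<in> {1..m}. h j = c})" for c
  have l: "l > 0" using C by (simp add: l_def card_gt_0_iff)
  have 1: "(\<Sum>c\<in>C. N c) = m"
    using sum_card_fibres[OF _ C(1) h, of "\<lambda>_. 1"] by (simp add: N_def)
  have 2: "(\<Sum>c\<in>C. (N c)\<^sup>2) = real m + 2 * real (matches m h)"
    unfolding N_def by (rule sum_square_card_fibres[OF C(1) h])
  have "(N c - a)\<^sup>2 = (N c)\<^sup>2 - 2 * a * N c + a\<^sup>2" for c a by (simp add: power2_diff)
  then have "(\<Sum>c\<in>C. (N c - a)\<^sup>2) = (\<Sum>c\<in>C. (N c)\<^sup>2) - 2 * a * (\<Sum>c\<in>C. N c) + l * a\<^sup>2" for a
    by (simp only: sum.distrib sum_subtractf sum_distrib_left[symmetric] sum_constant l_def)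
  then have "pearson_stat {1..m} C h = l / m * (real m + 2 * real (matches m h) - 2 * (m / l) * m + l * (m / l)\<^sup>2)"
    unfolding pearson_stat_def N_def[symmetric] 1 2 l_def[symmetric] by (simp add: 1 2)
  then have "real m / (2 * l) * (pearson_stat {1..m} C h - (l - 1)) =
      real (matches m h) - real m * (real m - 1) / 2 / l"
    using l m by (simp only:) (simp add: field_simps power2_eq_square)
  then show ?thesis by (simp only: l_def real_choose_2)
qed

text \<open>Each pair matches with probability \<open>1 / card C\<close>, and the affine relation
  converts this into the exact mean. As the statistic is nonnegative, the mean alone bounds its mean
  absolute deviation, which is all the concentration used later.\<close>

lemma expectation_pearson_stat:
  fixes C :: "'c set" and m :: nat
  assumes C: "finite C" "C \<noteq> {}" and m: "m \<ge> 1"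
  shows "(\<integral>h. pearson_stat {1..m} C h \<partial>measure_pmf (pmf_of_set ({1..m} \<rightarrow>\<^sub>E C))) = real (card C) - 1"
proof -
  let ?A = "{1..m} \<rightarrow>\<^sub>E C"
  have l: "real (card C) > 0" using C by (simp add: card_gt_0_iff)
  have A: "finite ?A" "real (card ?A) = card C ^ m" using C by (auto simp: finite_PiE card_PiE)
  have pair: "(\<Sum>h\<in>?A. of_bool (h i = h j)) = real (card ?A) / card C" if "(i, j) \<in> index_pairs m" for i j
  proof -
    \<comment> \<open>\<open>sum_PiE_match\<close> with the constant function 1 and the values 1 and
      0; it is complex-valued, hence the detour.\<close>
    have "(\<Sum>h\<in>?A. 1 * (if h i = h j then 1 else 0 :: complex)) = (\<Sum>h\<in>?A. 1) * ((1 + of_nat (card C - 1) * 0) / of_nat (card C))"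
      using that C by (intro sum_PiE_match) auto
    then have "complex_of_real (\<Sum>h\<in>?A. of_bool (h i = h j)) = complex_of_real (real (card ?A) / card C)"
      by (simp add: of_bool_def if_distrib cong: if_cong)
    then show ?thesis by (simp only: of_real_eq_iff)
  qed
  have "(\<Sum>h\<in>?A. real (matches m h)) = (\<Sum>h\<in>?A. \<Sum>(i, j)\<in>index_pairs m. of_bool (h i = h j))"
    unfolding matches_def using finite_index_pairs[of m]
    by (intro sum.cong refl) (simp add: case_prod_beta' sum.If_cases of_bool_def Int_def conj_commute)
  also have "\<dots> = (\<Sum>(i, j)\<in>index_pairs m. \<Sum>h\<in>?A. of_bool (h i = h j))"
    unfolding case_prod_beta' by (rule sum.swap)
  also have "\<dots> = (\<Sum>(i, j)\<in>index_pairs m. real (card ?A) / card C)"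
    using pair by (intro sum.cong) auto
  also have "\<dots> = real (m choose 2) * (real (card ?A) / card C)"
    using card_index_pairs[of m] by (simp add: case_prod_beta')
  finally have N: "(\<Sum>h\<in>?A. real (matches m h)) = real (m choose 2) * (real (card ?A) / card C)" .
  have "pearson_stat {1..m} C h = 2 * card C / m * (real (matches m h) - real (m choose 2) / card C) + (real (card C) - 1)"
    if "h \<in> ?A" for h
  proof -
    have "h ` {1..m} \<subseteq> C" using that by auto
    from matches_eq_pearson_stat[OF C m this] show ?thesis using l m by (simp only:) simp
  qed
  then have "(\<Sum>h\<in>?A. pearson_stat {1..m} C h) =
      (\<Sum>h\<in>?A. 2 * card C / m * (real (matches m h) - real (m choose 2) / card C) + (real (card C) - 1))"
    by (intro sum.cong) auto
  also have "\<dots> = 2 * card C / m * ((\<Sum>h\<in>?A. real (matches m h)) - real (card ?A) * (real (m choose 2) / card C))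
      + real (card ?A) * (real (card C) - 1)"
    by (simp only: sum.distrib sum_subtractf sum_distrib_left[symmetric] sum_constant right_diff_distrib)
  also have "\<dots> = real (card ?A) * (real (card C) - 1)" unfolding N by simp
  finally show ?thesis using C l A
    by (subst integral_pmf_of_set_PiE) auto
qed

section \<open>The limit of the averaged characteristic function\<close>

lemma exp_neg_lipschitz:
  fixes x y :: real
  assumes "0 \<le> x" "0 \<le> y"
  shows "\<bar>exp (- x) - exp (- y)\<bar> \<le> \<bar>x - y\<bar>"
proof -
  have *: "exp (- x) - exp (- y) \<le> y - x" if "0 \<le> x" "x \<le> y" for x y :: real
  proof -
    have "exp (- x) - exp (- y) = exp (- x) * (1 - exp (- (y - x)))"
      by (simp add: right_diff_distrib exp_add[symmetric])
    also have "\<dots> \<le> 1 * (y - x)"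
    proof (rule mult_mono)
      show "1 - exp (- (y - x)) \<le> y - x"
        using exp_ge_add_one_self[of "- (y - x)"] by linarith
    qed (use that in auto)
    finally show ?thesis by simp
  qed
  show ?thesis
  proof (cases "x \<le> y")
    case True
    then have "exp (- y) \<le> exp (- x)" by simp
    with *[OF assms(1) True] True show ?thesis by simp
  next
    case False
    then have "exp (- x) \<le> exp (- y)" by simp
    with *[OF assms(2), of x] False show ?thesis by simp
  qed
qed

text \<open>The bound sees the exponent \<open>N\<close> only through its distance from
  \<open>\<theta> * n\<close>, so it can be averaged over a random \<open>N\<close>. The first two
  terms pay for exchanging the bases for exponentials, the last for moving the resulting exponent to
  its value at \<open>N = \<theta> * n\<close>.\<close>

lemma norm_power_mult_power_diff_exp:
  fixes a b :: complex
  assumes ab: "norm a \<le> 1" "norm b \<le> 1" and uv: "0 \<le> u" "0 \<le> v" and n: "N \<le> n" "n \<ge> 1"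
    and \<theta>: "0 \<le> \<theta>" "\<theta> \<le> 1"
  shows "norm (a ^ (n - N) * b ^ N - of_real (exp (- ((1 - \<theta>) * u + \<theta> * v)))) \<le>
    real n * norm (a - of_real (exp (- u / n))) + real n * norm (b - of_real (exp (- v / n)))
      + \<bar>v - u\<bar> * \<bar>real N - \<theta> * n\<bar> / n"
proof -
  define e f where "e = exp (- u / n)" and "f = exp (- v / n)"
  have ef: "0 \<le> e" "e \<le> 1" "0 \<le> f" "f \<le> 1" using uv by (auto simp: e_def f_def)
  have 1: "norm (a ^ (n - N) - of_real e ^ (n - N)) \<le> real n * norm (a - of_real e)"
  proof -
    have "norm (a ^ (n - N) - of_real e ^ (n - N)) \<le> real (n - N) * norm (a - of_real e)"
      using ab ef by (intro norm_power_diff) auto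
    also have "\<dots> \<le> real n * norm (a - of_real e)" by (intro mult_right_mono) auto
    finally show ?thesis .
  qed
  have 2: "norm (b ^ N - of_real f ^ N) \<le> real n * norm (b - of_real f)"
  proof -
    have "norm (b ^ N - of_real f ^ N) \<le> real N * norm (b - of_real f)"
      using ab ef by (intro norm_power_diff) auto
    also have "\<dots> \<le> real n * norm (b - of_real f)" using n by (intro mult_right_mono) auto
    finally show ?thesis .
  qed
  have "a ^ (n - N) * b ^ N - of_real (e ^ (n - N) * f ^ N) =
      (a ^ (n - N) - of_real e ^ (n - N)) * b ^ N + of_real e ^ (n - N) * (b ^ N - of_real f ^ N)"
    by (simp add: algebra_simps)
  also have "norm \<dots> \<le> norm (a ^ (n - N) - of_real e ^ (n - N)) * 1 + 1 * norm (b ^ N - of_real f ^ N)"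
    using ab ef
    by (intro order_trans[OF norm_triangle_ineq] add_mono)
      (auto simp: norm_mult norm_power intro!: mult_left_mono mult_right_mono mult_left_le mult_left_le_one_le power_le_one)
  finally have 3: "norm (a ^ (n - N) * b ^ N - of_real (e ^ (n - N) * f ^ N)) \<le>
      real n * norm (a - of_real e) + real n * norm (b - of_real f)"
    using 1 2 by simp
  define w where "w = (1 - \<theta>) * u + \<theta> * v"
  define w' where "w' = real (n - N) * (u / n) + real N * (v / n)"
  have "e ^ (n - N) * f ^ N = exp (- w')"
    unfolding e_def f_def w'_def exp_of_nat_mult[symmetric] exp_add[symmetric] by simp
  moreover have "w' - w = (v - u) * (real N - \<theta> * n) / n"
    using n by (simp add: w'_def w_def of_nat_diff field_simps)
  moreover have "0 \<le> w" "0 \<le> w'" using uv \<theta> unfolding w_def w'_def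
    by (auto intro!: add_nonneg_nonneg mult_nonneg_nonneg divide_nonneg_nonneg)
  ultimately have "\<bar>e ^ (n - N) * f ^ N - exp (- w)\<bar> \<le> \<bar>v - u\<bar> * \<bar>real N - \<theta> * n\<bar> / n"
    using exp_neg_lipschitz[of w' w] by (simp add: abs_mult)
  then have "norm (of_real (e ^ (n - N) * f ^ N) - of_real (exp (- w)) :: complex) \<le> \<bar>v - u\<bar> * \<bar>real N - \<theta> * n\<bar> / n"
    by (simp only: of_real_diff[symmetric] norm_of_real)
  with 3 show ?thesis
    using norm_triangle_ineq[of "a ^ (n - N) * b ^ N - of_real (e ^ (n - N) * f ^ N)"
        "of_real (e ^ (n - N) * f ^ N) - of_real (exp (- w))"]
    unfolding w_def e_def f_def by simp
qed

lemma norm_iexp_diff: "norm (iexp x - iexp y) \<le> \<bar>x - y\<bar>"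
proof -
  have "iexp x - iexp y = iexp y * (iexp (x - y) - 1)"
    by (simp add: right_diff_distrib exp_add[symmetric] of_real_diff)
  then have "norm (iexp x - iexp y) = norm (iexp (x - y) - 1)" by (simp only: norm_mult) simp
  also have "\<dots> \<le> \<bar>x - y\<bar>" using iexp_approx1[of "x - y" 0] by simp
  finally show ?thesis .
qed

lemma filterlim_choose_2: "filterlim (\<lambda>m::nat. m choose 2) sequentially sequentially"
proof (rule filterlim_at_top_mono[OF filterlim_ident[of sequentially, THEN filterlim_compose[OF filterlim_minus_const_nat_at_top[of 1]]]])
  show "\<forall>\<^sub>F m in sequentially. m - 1 \<le> m choose 2"
  proof (rule eventually_sequentiallyI)
    fix m :: nat assume "2 \<le> m"
    then have "2 * (m - 1) \<le> m * (m - 1)" by simp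
    then show "m - 1 \<le> m choose 2" by (simp add: choose_two less_eq_div_iff_mult_less_eq mult.commute)
  qed
qed

text \<open>Three replacements: the powers by their deterministic limit, the coefficient
  \<open>\<kappa>' m\<close> of \<open>T - (l - 1)\<close> in the phase by \<open>\<kappa>\<close>,
  and the law of \<open>T\<close> by chi-squared. The constant is
  \<open>\<kappa> = \<delta> * sqrt 2 / (2 * l)\<close>, since \<open>m / sqrt (n m)\<close> tends
  to \<open>sqrt 2\<close>.\<close>

lemma mixture_char_tendsto:
  fixes C :: "'c set" and \<alpha> \<beta> :: "nat \<Rightarrow> complex" and u v \<delta> :: real
  assumes C: "finite C" "card C \<ge> 2" and uv: "u \<ge> 0" "v \<ge> 0"
    and \<alpha>: "\<And>n. norm (\<alpha> n) \<le> 1" "(\<lambda>n. real n * norm (\<alpha> n - of_real (exp (- u / n)))) \<longlonglongrightarrow> 0"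
    and \<beta>: "\<And>n. norm (\<beta> n) \<le> 1" "(\<lambda>n. real n * norm (\<beta> n - of_real (exp (- v / n)))) \<longlonglongrightarrow> 0"
  defines "n \<equiv> \<lambda>m. m choose 2" and "l \<equiv> real (card C)"
  defines "\<kappa> \<equiv> \<delta> / (sqrt 2 * l)"
  shows "(\<lambda>m. \<integral>h. \<alpha> (n m) ^ (n m - matches m h) * \<beta> (n m) ^ matches m h *
      iexp (\<delta> * (real (matches m h) - n m / l) / sqrt (n m))
      \<partial>measure_pmf (pmf_of_set ({1..m} \<rightarrow>\<^sub>E C)))
    \<longlonglongrightarrow> of_real (exp (- ((1 - 1 / l) * u + 1 / l * v))) *
        (iexp (- \<kappa> * (l - 1)) * char (chi2_distribution (card C - 1)) \<kappa>)"
proof -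
  let ?A = "\<lambda>m::nat. {1..m} \<rightarrow>\<^sub>E C"
  let ?p = "\<lambda>m. measure_pmf (pmf_of_set (?A m))"
  let ?E = "\<lambda>m f. complex_lebesgue_integral (?p m) f"
  let ?ab = "\<lambda>m h. \<alpha> (n m) ^ (n m - matches m h) * \<beta> (n m) ^ matches m h"
  let ?x = "\<lambda>m h. iexp (\<delta> * (real (matches m h) - n m / l) / sqrt (n m))"
  let ?w = "exp (- ((1 - 1 / l) * u + 1 / l * v))"
  define T where "T m = pearson_stat {1..m} C" for m :: nat
  define \<kappa>' where "\<kappa>' m = \<delta> * real m / (2 * l * sqrt (n m))" for m
  have l: "l \<ge> 2" "C \<noteq> {}" using C by (auto simp: l_def)
  have A: "finite (?A m)" "?A m \<noteq> {}" for m using C l by (auto simp: finite_PiE PiE_eq_empty_iff)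
  have int: "integrable (?p m) f" for m and f :: "_ \<Rightarrow> 'b :: {banach, second_countable_topology}"
    using A by (intro integrable_measure_pmf_finite) auto
  have AE_p: "AE h in ?p m. h \<in> ?A m" for m using A by (simp add: AE_measure_pmf_iff)
  \<comment> \<open>Nonnegativity of \<open>T\<close> bounds the integrand by
    \<open>T + (l - 1)\<close>, whose mean is \<open>2 * (l - 1)\<close>.\<close>
  have abs_T: "(\<integral>h. \<bar>T m h - (l - 1)\<bar> \<partial>?p m) \<le> 2 * (l - 1)" if "m \<ge> 1" for m
  proof -
    have "(\<integral>h. \<bar>T m h - (l - 1)\<bar> \<partial>?p m) \<le> (\<integral>h. T m h + (l - 1) \<partial>?p m)"
      using l pearson_stat_nonneg by (intro integral_mono int) (auto simp: T_def abs_if)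
    also have "\<dots> = (\<integral>h. T m h \<partial>?p m) + (\<integral>h. l - 1 \<partial>?p m)"
      by (rule Bochner_Integration.integral_add[OF int int])
    also have "\<dots> = 2 * (l - 1)"
      using expectation_pearson_stat[OF C(1) l(2) that] by (simp add: T_def l_def)
    finally show ?thesis .
  qed
  have dev: "real (matches m h) - n m / l = m / (2 * l) * (T m h - (l - 1))" if "m \<ge> 1" "h \<in> ?A m" for m h
    unfolding n_def l_def T_def using that by (intro matches_eq_pearson_stat C l(2)) auto

  have "(\<lambda>m. ?E m (\<lambda>h. ?ab m h * ?x m h) - of_real ?w * ?E m (?x m)) \<longlonglongrightarrow> 0"
  proof (rule Lim_null_comparison)
    \<comment> \<open>The last term is
      \<open>\<bar>v - u\<bar> * (m / (2 * l)) / n m * (2 * (l - 1))\<close> with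
      \<open>n m = m * (m - 1) / 2\<close> inserted: the proportion of matches deviates from
      \<open>1 / l\<close> by order 1 / m in mean.\<close>
    let ?r = "\<lambda>m. real (n m) * norm (\<alpha> (n m) - of_real (exp (- u / n m))) +
        real (n m) * norm (\<beta> (n m) - of_real (exp (- v / n m))) + \<bar>v - u\<bar> * (2 * (l - 1) / l) / (real m - 1)"
    show "\<forall>\<^sub>F m in sequentially. norm (?E m (\<lambda>h. ?ab m h * ?x m h) - of_real ?w * ?E m (?x m)) \<le> ?r m"
    proof (rule eventually_sequentiallyI)
      fix m :: nat assume m: "2 \<le> m"
      then have n: "n m \<ge> 1" "real (n m) = real m * (real m - 1) / 2"
        by (auto simp: n_def real_choose_2 Suc_le_eq)
      let ?q = "real (n m) * norm (\<alpha> (n m) - of_real (exp (- u / n m))) +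
        real (n m) * norm (\<beta> (n m) - of_real (exp (- v / n m)))"
      have "norm (?E m (\<lambda>h. ?ab m h * ?x m h) - of_real ?w * ?E m (?x m)) =
          norm (?E m (\<lambda>h. (?ab m h - of_real ?w) * ?x m h))"
        unfolding integral_mult_right_zero[symmetric] left_diff_distrib
        by (subst Bochner_Integration.integral_diff[OF int int]) (rule refl)
      also have "\<dots> \<le> (\<integral>h. norm ((?ab m h - of_real ?w) * ?x m h) \<partial>?p m)"
        by (rule integral_norm_bound)
      also have "\<dots> \<le> (\<integral>h. ?q + \<bar>v - u\<bar> * (m / (2 * l)) / n m * \<bar>T m h - (l - 1)\<bar> \<partial>?p m)"
      proof (rule integral_mono_AE)
        show "AE h in ?p m. norm ((?ab m h - of_real ?w) * ?x m h) \<le>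
          ?q + \<bar>v - u\<bar> * (m / (2 * l)) / n m * \<bar>T m h - (l - 1)\<bar>"
          using AE_p
        proof eventually_elim
          case (elim h)
          have "norm ((?ab m h - of_real ?w) * ?x m h) = norm (?ab m h - of_real ?w)"
            unfolding norm_mult by simp
          also have "\<dots> \<le> ?q + \<bar>v - u\<bar> * \<bar>real (matches m h) - 1 / l * n m\<bar> / n m"
            using \<alpha>(1) \<beta>(1) uv l n matches_le[of m h]
            by (intro norm_power_mult_power_diff_exp) (auto simp: n_def)
          also have "real (matches m h) - 1 / l * n m = m / (2 * l) * (T m h - (l - 1))"
            using dev[OF _ elim] m by simp
          also have "\<bar>\<dots>\<bar> = (m / (2 * l)) * \<bar>T m h - (l - 1)\<bar>" using l by (simp add: abs_mult)
          finally show ?case by simp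
        qed
      qed (rule int)+
      also have "\<dots> = ?q + \<bar>v - u\<bar> * (m / (2 * l)) / n m * (\<integral>h. \<bar>T m h - (l - 1)\<bar> \<partial>?p m)"
        by (subst Bochner_Integration.integral_add[OF int int]) simp
      also have "\<dots> \<le> ?q + \<bar>v - u\<bar> * (m / (2 * l)) / n m * (2 * (l - 1))"
        using abs_T[of m] m l by (intro add_left_mono mult_left_mono) auto
      also have "\<dots> = ?r m" unfolding n(2) using m l by (simp add: field_simps)
      finally show "norm (?E m (\<lambda>h. ?ab m h * ?x m h) - of_real ?w * ?E m (?x m)) \<le> ?r m" .
    qed
    have "(\<lambda>m. \<bar>v - u\<bar> * (2 * (l - 1) / l) / (real m - 1)) \<longlonglongrightarrow> 0" by real_asymp
    from tendsto_add[OF tendsto_add[OF filterlim_compose[OF \<alpha>(2) filterlim_choose_2]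
          filterlim_compose[OF \<beta>(2) filterlim_choose_2]] this]
    show "?r \<longlonglongrightarrow> 0" by (simp add: n_def)
  qed
  moreover have "(\<lambda>m. ?E m (?x m) - ?E m (\<lambda>h. iexp (\<kappa> * (T m h - (l - 1))))) \<longlonglongrightarrow> 0"
  proof (rule Lim_null_comparison)
    show "\<forall>\<^sub>F m in sequentially. norm (?E m (?x m) - ?E m (\<lambda>h. iexp (\<kappa> * (T m h - (l - 1))))) \<le>
        \<bar>\<kappa>' m - \<kappa>\<bar> * (2 * (l - 1))"
    proof (rule eventually_sequentiallyI)
      fix m :: nat assume m: "1 \<le> m"
      have "norm (?E m (?x m) - ?E m (\<lambda>h. iexp (\<kappa> * (T m h - (l - 1))))) =
         norm (?E m (\<lambda>h. ?x m h - iexp (\<kappa> * (T m h - (l - 1)))))"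
        by (subst Bochner_Integration.integral_diff[OF int int]) (rule refl)
      also have "\<dots> \<le> (\<integral>h. norm (?x m h - iexp (\<kappa> * (T m h - (l - 1)))) \<partial>?p m)"
        by (rule integral_norm_bound)
      also have "\<dots> \<le> (\<integral>h. \<bar>\<kappa>' m - \<kappa>\<bar> * \<bar>T m h - (l - 1)\<bar> \<partial>?p m)"
      proof (rule integral_mono_AE)
        show "AE h in ?p m. norm (?x m h - iexp (\<kappa> * (T m h - (l - 1)))) \<le> \<bar>\<kappa>' m - \<kappa>\<bar> * \<bar>T m h - (l - 1)\<bar>"
          using AE_p
        proof eventually_elim
          case (elim h)
          have eq: "\<delta> * (real (matches m h) - n m / l) / sqrt (n m) = \<kappa>' m * (T m h - (l - 1))"
            unfolding dev[OF m elim] \<kappa>'_def by simp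
          have "norm (?x m h - iexp (\<kappa> * (T m h - (l - 1)))) \<le> \<bar>\<kappa>' m * (T m h - (l - 1)) - \<kappa> * (T m h - (l - 1))\<bar>"
            unfolding eq by (rule norm_iexp_diff)
          then show ?case by (simp only: left_diff_distrib[symmetric] abs_mult)
        qed
      qed (rule int)+
      also have "\<dots> \<le> \<bar>\<kappa>' m - \<kappa>\<bar> * (2 * (l - 1))"
        using abs_T[OF m] by (simp add: mult_left_mono)
      finally show "norm (?E m (?x m) - ?E m (\<lambda>h. iexp (\<kappa> * (T m h - (l - 1))))) \<le> \<bar>\<kappa>' m - \<kappa>\<bar> * (2 * (l - 1))" .
    qed
    \<comment> \<open>The limit of \<open>m / sqrt (n m)\<close> read off from
      \<open>n m = m * (m - 1) / 2\<close>, here identified with \<open>sqrt 2\<close>.\<close>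
    have "inverse ((1 / 2) powr (1 / 2)) = sqrt 2"
      by (simp add: powr_half_sqrt real_sqrt_divide)
    moreover have "(\<lambda>m. real m / sqrt (real m * (real m - 1) / 2)) \<longlonglongrightarrow> inverse ((1 / 2) powr (1 / 2))"
      by real_asymp
    ultimately have "(\<lambda>m. real m / sqrt (real m * (real m - 1) / 2)) \<longlonglongrightarrow> sqrt 2" by simp
    then have "(\<lambda>m. \<delta> / (2 * l) * (real m / sqrt (real m * (real m - 1) / 2))) \<longlonglongrightarrow> \<delta> / (2 * l) * sqrt 2"
      by (intro tendsto_intros)
    also have "\<delta> / (2 * l) * sqrt 2 = \<kappa>" using l by (simp add: \<kappa>_def real_div_sqrt field_simps)
    finally have "\<kappa>' \<longlonglongrightarrow> \<kappa>" by (simp add: \<kappa>'_def[abs_def] n_def real_choose_2)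
    then show "(\<lambda>m. \<bar>\<kappa>' m - \<kappa>\<bar> * (2 * (l - 1))) \<longlonglongrightarrow> 0"
      by (intro tendsto_mult_left_zero tendsto_rabs_zero) (simp add: LIM_zero)
  qed
  moreover have "(\<lambda>m. ?E m (\<lambda>h. iexp (\<kappa> * (T m h - (l - 1))))) \<longlonglongrightarrow>
      iexp (- \<kappa> * (l - 1)) * char (chi2_distribution (card C - 1)) \<kappa>"
  proof -
    have "iexp (\<kappa> * (T m h - (l - 1))) = iexp (- \<kappa> * (l - 1)) * iexp (\<kappa> * T m h)" for m h
      by (simp add: exp_add[symmetric] algebra_simps)
    then have "?E m (\<lambda>h. iexp (\<kappa> * (T m h - (l - 1)))) = iexp (- \<kappa> * (l - 1)) * ?E m (\<lambda>h. iexp (\<kappa> * T m h))" for m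
      by (simp only: integral_mult_right_zero)
    then show ?thesis
      unfolding T_def by (simp only:) (intro tendsto_mult tendsto_const pearson_char_tendsto C)
  qed
  ultimately have *: "(\<lambda>m. (?E m (\<lambda>h. ?ab m h * ?x m h) - of_real ?w * ?E m (?x m)) +
      of_real ?w * ((?E m (?x m) - ?E m (\<lambda>h. iexp (\<kappa> * (T m h - (l - 1))))) + ?E m (\<lambda>h. iexp (\<kappa> * (T m h - (l - 1))))))
     \<longlonglongrightarrow> 0 + of_real ?w * (0 + (iexp (- \<kappa> * (l - 1)) * char (chi2_distribution (card C - 1)) \<kappa>))"
    by (intro tendsto_intros)
  then show ?thesis by simp
qed

section \<open>Conditioning and the limit law\<close>

text \<open>A real-valued density makes the Bochner integral rules for densities applicable.\<close>

lemma (in prob_space) uniform_measure_eq_density: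
  assumes "A \<in> sets M" "measure M A > 0"
  shows "uniform_measure M A = density M (\<lambda>x. ennreal (indicator A x / measure M A))"
proof -
  have "indicator A x / emeasure M A = ennreal (indicator A x / measure M A)" for x
    using assms by (simp add: emeasure_eq_measure divide_ennreal[symmetric] ennreal_indicator)
  then show ?thesis unfolding uniform_measure_def by simp
qed

lemma (in prob_space) uniform_measure_integral:
  fixes f :: "'a \<Rightarrow> real"
  assumes A: "A \<in> sets M" "measure M A > 0" and f: "integrable M f"
  shows integrable_uniform_measure: "integrable (uniform_measure M A) f"
    and integral_uniform_measure: "measure M A * (\<integral>x. f x \<partial>uniform_measure M A) = (\<integral>x. indicator A x * f x \<partial>M)"
proof -
  have f_meas: "f \<in> borel_measurable M" using f by simp
  have [measurable]: "A \<in> sets M" by (rule A(1))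
  have "integrable M (\<lambda>x. indicator A x *\<^sub>R f x)"
    using A(1) f by (rule integrable_mult_indicator)
  then have int: "integrable M (\<lambda>x. (indicator A x / measure M A) *\<^sub>R f x)" by simp
  have g: "(\<lambda>x. indicator A x / measure M A) \<in> borel_measurable M"
    "AE x in M. 0 \<le> indicator A x / measure M A" by simp_all
  show "integrable (uniform_measure M A) f"
  proof -
    have "integrable (density M (\<lambda>x. ennreal (indicator A x / measure M A))) f = integrable M (\<lambda>x. (indicator A x / measure M A) *\<^sub>R f x)"
      by (rule integrable_density[OF f_meas g])
    then have "integrable (density M (\<lambda>x. ennreal (indicator A x / measure M A))) f" using int by (rule iffD2)
    then show ?thesis by (subst uniform_measure_eq_density[OF A])
  qed
  have "(\<integral>x. f x \<partial>uniform_measure M A) = (\<integral>x. (indicator A x / measure M A) *\<^sub>R f x \<partial>M)"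
    by (subst uniform_measure_eq_density[OF A]) (rule integral_density[OF f_meas g])
  also have "\<dots> = (\<integral>x. indicator A x * f x \<partial>M) / measure M A" by simp
  finally show "measure M A * (\<integral>x. f x \<partial>uniform_measure M A) = (\<integral>x. indicator A x * f x \<partial>M)"
    using A by simp
qed

context real_distribution
begin

lemma real_distribution_uniform_measure:
  assumes "A \<in> sets borel" "measure M A > 0"
  shows "real_distribution (uniform_measure M A)"
proof -
  have "prob_space (uniform_measure M A)"
    using assms by (intro prob_space_uniform_measure) (auto simp: emeasure_eq_measure)
  then show ?thesis by (simp add: real_distribution_def real_distribution_axioms_def)
qed

lemma expectation_split:
  assumes A: "A \<in> sets borel" "measure M A > 0" "measure M A < 1" and f: "integrable M f"
  shows "expectation f = measure M A * (\<integral>x. f x \<partial>uniform_measure M A)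
    + (1 - measure M A) * (\<integral>x. f x \<partial>uniform_measure M (- A))"
proof -
  have compl: "measure M (- A) = 1 - measure M A"
    using A prob_compl[of A] by (simp add: Compl_eq_Diff_UNIV)
  have "expectation f = (\<integral>x. indicator A x * f x + indicator (- A) x * f x \<partial>M)"
    by (rule Bochner_Integration.integral_cong) (auto simp: indicator_def)
  also have "\<dots> = (\<integral>x. indicator A x * f x \<partial>M) + (\<integral>x. indicator (- A) x * f x \<partial>M)"
    using integrable_mult_indicator[OF _ f, of A] integrable_mult_indicator[OF _ f, of "- A"] A
    by (intro Bochner_Integration.integral_add) auto
  also have "\<dots> = measure M A * (\<integral>x. f x \<partial>uniform_measure M A)
    + measure M (- A) * (\<integral>x. f x \<partial>uniform_measure M (- A))"
    using integral_uniform_measure[OF _ _ f, of A] integral_uniform_measure[OF _ _ f, of "- A"] A compl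
    by simp
  finally show ?thesis by (simp add: compl)
qed

lemma second_moment_about:
  assumes i2: "integrable M (\<lambda>x. x\<^sup>2)"
  shows "expectation (\<lambda>x. (x - a)\<^sup>2) = variance (\<lambda>x. x) + (expectation (\<lambda>x. x) - a)\<^sup>2"
    and "integrable M (\<lambda>x. (x - a)\<^sup>2)"
proof -
  have i1: "integrable M (\<lambda>x. x)" by (rule square_integrable_imp_integrable[OF _ i2]) simp
  have E: "expectation (\<lambda>x. (x - b)\<^sup>2) = expectation (\<lambda>x. x\<^sup>2) - 2 * b * expectation (\<lambda>x. x) + b\<^sup>2" for b
  proof -
    have "(x - b)\<^sup>2 = x\<^sup>2 - (2 * b) * x + b\<^sup>2" for x by (simp add: power2_diff)
    then show ?thesis using i1 i2 prob_space by simp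
  qed
  show "expectation (\<lambda>x. (x - a)\<^sup>2) = variance (\<lambda>x. x) + (expectation (\<lambda>x. x) - a)\<^sup>2"
    unfolding E by (simp add: power2_eq_square algebra_simps)
  have "(x - a)\<^sup>2 = x\<^sup>2 - (2 * a) * x + a\<^sup>2" for x by (simp add: power2_diff)
  then show "integrable M (\<lambda>x. (x - a)\<^sup>2)" using i1 i2 by simp
qed

text \<open>Law of total variance for the cells \<open>A\<close> and \<open>- A\<close>: each cell
  is expanded about the overall mean by \<open>second_moment_about\<close>. The last summand, the
  variance between the cells, will become \<open>r\<^sup>2 * \<sigma>\<^sup>2\<close>.\<close>

lemma variance_split:
  assumes A: "A \<in> sets borel" "measure M A > 0" "measure M A < 1" and i2: "integrable M (\<lambda>x. x\<^sup>2)"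
  defines "p \<equiv> measure M A" and "E \<equiv> \<lambda>B f. (\<integral>x. f x \<partial>uniform_measure M B) :: real"
  defines "d \<equiv> \<lambda>B. E B (\<lambda>x. x)"
  shows "expectation (\<lambda>x. x) = p * d A + (1 - p) * d (- A)"
    and "variance (\<lambda>x. x) = p * E A (\<lambda>x. (x - d A)\<^sup>2) + (1 - p) * E (- A) (\<lambda>x. (x - d (- A))\<^sup>2)
      + p * (1 - p) * (d A - d (- A))\<^sup>2"
proof -
  have i1: "integrable M (\<lambda>x. x)" by (rule square_integrable_imp_integrable[OF _ i2]) simp
  have compl: "measure M (- A) > 0"
    using A prob_compl[of A] by (simp add: Compl_eq_Diff_UNIV)
  show mean: "expectation (\<lambda>x. x) = p * d A + (1 - p) * d (- A)"
    unfolding p_def d_def E_def by (rule expectation_split[OF A i1])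
  have B: "E B (\<lambda>x. (x - a)\<^sup>2) = E B (\<lambda>x. (x - d B)\<^sup>2) + (d B - a)\<^sup>2"
    if "B \<in> sets borel" "measure M B > 0" for B a
  proof -
    interpret B: real_distribution "uniform_measure M B"
      using that by (rule real_distribution_uniform_measure)
    have "integrable (uniform_measure M B) (\<lambda>x. x\<^sup>2)"
      using that i2 by (intro integrable_uniform_measure) auto
    then show ?thesis unfolding E_def d_def by (rule B.second_moment_about)
  qed
  define \<mu> where "\<mu> = expectation (\<lambda>x. x)"
  have "variance (\<lambda>x. x) = p * E A (\<lambda>x. (x - \<mu>)\<^sup>2) + (1 - p) * E (- A) (\<lambda>x. (x - \<mu>)\<^sup>2)"
    unfolding p_def E_def \<mu>_def by (rule expectation_split[OF A second_moment_about(2)[OF i2]])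
  also have "\<dots> = p * (E A (\<lambda>x. (x - d A)\<^sup>2) + (d A - \<mu>)\<^sup>2) + (1 - p) * (E (- A) (\<lambda>x. (x - d (- A))\<^sup>2) + (d (- A) - \<mu>)\<^sup>2)"
    using A compl by (subst (1 2) B) auto
  finally show "variance (\<lambda>x. x) = p * E A (\<lambda>x. (x - d A)\<^sup>2) + (1 - p) * E (- A) (\<lambda>x. (x - d (- A))\<^sup>2)
      + p * (1 - p) * (d A - d (- A))\<^sup>2"
    unfolding \<mu>_def mean by (simp add: power2_eq_square algebra_simps)
qed

lemma centred_char_approx:
  assumes i2: "integrable M (\<lambda>x. x\<^sup>2)"
  defines "\<phi> \<equiv> \<lambda>s. \<integral>x. iexp (s * (x - expectation (\<lambda>x. x))) \<partial>M"
  shows "norm (\<phi> s) \<le> 1"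
    and "(\<lambda>n. real n * norm (\<phi> (s / sqrt (real n)) - of_real (exp (- (s\<^sup>2 * variance (\<lambda>x. x) / 2) / real n)))) \<longlonglongrightarrow> 0"
proof -
  have i1: "integrable M (\<lambda>x. x)" by (rule square_integrable_imp_integrable[OF _ i2]) simp
  define \<mu> where "\<mu> = expectation (\<lambda>x. x)"
  define D where "D = distr M borel (\<lambda>x. x - \<mu>)"
  have D_meas: "(\<lambda>x. x - \<mu>) \<in> borel_measurable M" by simp
  have D_int: "(\<integral>x. f x \<partial>D) = (\<integral>x. f (x - \<mu>) \<partial>M)" if "f \<in> borel_measurable borel"
    for f :: "real \<Rightarrow> 'b :: {banach, second_countable_topology}"
    unfolding D_def by (rule integral_distr[OF D_meas that])
  have D_integrable: "integrable D f" if "f \<in> borel_measurable borel" "integrable M (\<lambda>x. f (x - \<mu>))"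
    for f :: "real \<Rightarrow> real"
    unfolding D_def by (rule integrable_distr_eq[OF D_meas that(1), THEN iffD2, OF that(2)])
  have D: "real_distribution D" unfolding D_def by (rule real_distribution_distr[OF D_meas])
  have \<phi>: "\<phi> s = char D s" for s
    unfolding \<phi>_def char_def \<mu>_def[symmetric] by (rule D_int[symmetric]) simp
  show "norm (\<phi> s) \<le> 1" unfolding \<phi> by (rule real_distribution.cmod_char_le_1[OF D])
  have "integrable M (\<lambda>x. x - \<mu>)" using i1 by simp
  then have d1: "integrable D (\<lambda>x. x)" by (intro D_integrable) simp_all
  have "(\<integral>x. x - \<mu> \<partial>M) = 0" using i1 prob_space by (simp add: \<mu>_def)
  then have e1: "(\<integral>x. x \<partial>D) = 0" by (subst D_int) simp_all
  have d2: "integrable D (\<lambda>x. x\<^sup>2)"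
    by (rule D_integrable[OF _ second_moment_about(2)[OF i2]]) simp
  have e2: "(\<integral>x. x\<^sup>2 \<partial>D) = variance (\<lambda>x. x)"
    unfolding \<mu>_def[symmetric] by (rule D_int) simp
  show "(\<lambda>n. real n * norm (\<phi> (s / sqrt (real n)) - of_real (exp (- (s\<^sup>2 * variance (\<lambda>x. x) / 2) / real n)))) \<longlonglongrightarrow> 0"
    unfolding \<phi> by (rule real_distribution.char_scaled_approx[OF D d1 e1 d2 e2])
qed

end

section \<open>Characteristic functions of the limit law and of the mixture\<close>

lemma limit_law_eq:
  "limit_law l r = distr (std_normal_distribution \<Otimes>\<^sub>M chi2_distribution (l - 1)) borel
     (\<lambda>(z, g). sqrt (1 - r\<^sup>2) * z + r * ((g - real (l - 1)) / sqrt (2 * real (l - 1))))"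
  by (simp add: limit_law_def chi2_distribution_def)

text \<open>\<open>\<kappa>\<close> is the coefficient of the chi-squared variable in
  \<open>t\<close> times the limit variable, and the extra phase comes from its centring at
  \<open>l - 1\<close>. The bound on \<open>r\<close> makes \<open>sqrt (1 - r\<^sup>2)\<close>
  square to \<open>1 - r\<^sup>2\<close>.\<close>

lemma limit_law:
  fixes r t :: real
  assumes l: "l \<ge> 2" and r: "r\<^sup>2 \<le> 1"
  defines "\<kappa> \<equiv> t * r / sqrt (2 * real (l - 1))"
  shows real_distribution_limit_law: "real_distribution (limit_law l r)"
    and char_limit_law: "char (limit_law l r) t = of_real (exp (- (t\<^sup>2 * (1 - r\<^sup>2) / 2))) *
      (iexp (- \<kappa> * real (l - 1)) * char (chi2_distribution (l - 1)) \<kappa>)"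
proof -
  interpret Z: real_distribution std_normal_distribution by (rule real_dist_normal_dist)
  interpret X: real_distribution "chi2_distribution (l - 1)"
    using l by (intro real_distribution_chi2) auto
  interpret ZX: pair_prob_space std_normal_distribution "chi2_distribution (l - 1)" ..
  let ?f = "\<lambda>(z, g). sqrt (1 - r\<^sup>2) * z + r * ((g - real (l - 1)) / sqrt (2 * real (l - 1)))"
  have [measurable]: "?f \<in> borel_measurable (std_normal_distribution \<Otimes>\<^sub>M chi2_distribution (l - 1))"
    by measurable
  show "real_distribution (limit_law l r)"
    unfolding limit_law_eq by (rule ZX.real_distribution_distr) measurable
  define a where "a = t * sqrt (1 - r\<^sup>2)"
  define c where "c = iexp (- \<kappa> * real (l - 1))"
  have split: "iexp (t * ?f x) = iexp (a * fst x) * (c * iexp (\<kappa> * snd x))" for x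
    by (cases x) (simp add: c_def exp_add[symmetric] a_def \<kappa>_def algebra_simps diff_divide_distrib)
  have int: "integrable (std_normal_distribution \<Otimes>\<^sub>M chi2_distribution (l - 1))
      (\<lambda>x. iexp (a * fst x) * (c * iexp (\<kappa> * snd x)))"
  proof (rule ZX.integrable_const_bound[of _ 1])
    show "AE x in std_normal_distribution \<Otimes>\<^sub>M chi2_distribution (l - 1).
        norm (iexp (a * fst x) * (c * iexp (\<kappa> * snd x))) \<le> 1"
      by (simp add: norm_mult c_def)
  qed measurable
  have "char (limit_law l r) t =
      (\<integral>x. iexp (t * ?f x) \<partial>(std_normal_distribution \<Otimes>\<^sub>M chi2_distribution (l - 1)))"
    unfolding char_def limit_law_eq by (rule integral_distr; measurable)
  also have "\<dots> = (\<integral>z. \<integral>g. iexp (a * z) * (c * iexp (\<kappa> * g)) \<partial>chi2_distribution (l - 1) \<partial>std_normal_distribution)"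
    unfolding split using ZX.integral_fst'[OF int] by simp
  also have "\<dots> = (\<integral>z. iexp (a * z) \<partial>std_normal_distribution) *
      (c * (\<integral>g. iexp (\<kappa> * g) \<partial>chi2_distribution (l - 1)))"
    by (simp only: integral_mult_right_zero integral_mult_left_zero)
  also have "(\<integral>z. iexp (a * z) \<partial>std_normal_distribution) = of_real (exp (- a\<^sup>2 / 2))"
    using char_std_normal_distribution[THEN fun_cong, of a] by (simp only: char_def)
  also have "- a\<^sup>2 / 2 = - (t\<^sup>2 * (1 - r\<^sup>2) / 2)"
    using r by (simp add: a_def power_mult_distrib)
  finally show "char (limit_law l r) t = of_real (exp (- (t\<^sup>2 * (1 - r\<^sup>2) / 2))) *
      (iexp (- \<kappa> * real (l - 1)) * char (chi2_distribution (l - 1)) \<kappa>)"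
    by (simp only: char_def c_def)
qed

text \<open>With one common \<open>g\<close> a configuration enters only through its number of
  matching pairs, so a single statistic of the labels governs the limit.\<close>

lemma (in categorical_mixture) expectation_prod_mixture_const:
  fixes g :: "real \<Rightarrow> complex"
  assumes g: "g \<in> borel_measurable borel" "\<And>x. norm (g x) \<le> 1"
  shows "expectation (\<lambda>\<omega>. \<Prod>k\<in>K. g (X k \<omega>)) =
    (\<integral>h. (\<integral>x. g x \<partial>\<mu>\<^sub>U) ^ (card K - card {k\<in>K. h (p k) = h (q k)}) *
       (\<integral>x. g x \<partial>\<mu>\<^sub>V) ^ card {k\<in>K. h (p k) = h (q k)} \<partial>measure_pmf (pmf_of_set (J \<rightarrow>\<^sub>E C)))"
proof -
  have "(\<Prod>k\<in>K. if h (p k) = h (q k) then b else a) =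
      a ^ (card K - card {k\<in>K. h (p k) = h (q k)}) * b ^ card {k\<in>K. h (p k) = h (q k)}"
    for h :: "'j \<Rightarrow> nat" and a b :: complex
  proof -
    have "K \<inter> - {k. h (p k) = h (q k)} = K - {k\<in>K. h (p k) = h (q k)}"
      "K \<inter> {k. h (p k) = h (q k)} = {k\<in>K. h (p k) = h (q k)}" by auto
    then show ?thesis using fin(2) by (subst prod.If_cases) (simp_all add: card_Diff_subset mult.commute)
  qed
  then show ?thesis
    using expectation_prod_mixture[of "\<lambda>_. g"] g fin by (simp add: integral_pmf_of_set_PiE)
qed

section \<open>The theorem\<close>

theorem theorem1:
  fixes F :: "real measure" and l :: nat and A :: "real set"
    and P :: "nat \<Rightarrow> 'a measure"
    and M :: "nat \<Rightarrow> nat \<Rightarrow> 'a \<Rightarrow> nat"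
    and U V X :: "nat \<Rightarrow> nat \<Rightarrow> 'a \<Rightarrow> real"
  assumes F: "real_distribution F"
    and var_fin: "integrable F (\<lambda>x. x\<^sup>2)"
    and l: "l \<ge> 2"
    and A: "A \<in> sets borel"
    and PA: "measure F A = 1 / real l"
    and cond_means: "(\<integral>x. x \<partial>(uniform_measure F A)) \<noteq> (\<integral>x. x \<partial>(uniform_measure F (- A)))"
    and P: "\<And>m. m \<ge> 2 \<Longrightarrow> prob_space (P m)"
    and M_meas: "\<And>m j. m \<ge> 2 \<Longrightarrow> j \<in> {1..m} \<Longrightarrow> M m j \<in> measurable (P m) (count_space UNIV)"
    and M_distr: "\<And>m j. m \<ge> 2 \<Longrightarrow> j \<in> {1..m} \<Longrightarrow>
        distr (P m) (count_space UNIV) (M m j) = measure_pmf (pmf_of_set {0..<l})"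
    and U_meas: "\<And>m k. m \<ge> 2 \<Longrightarrow> k \<in> {1..m choose 2} \<Longrightarrow> U m k \<in> borel_measurable (P m)"
    and V_meas: "\<And>m k. m \<ge> 2 \<Longrightarrow> k \<in> {1..m choose 2} \<Longrightarrow> V m k \<in> borel_measurable (P m)"
    and U_distr: "\<And>m k. m \<ge> 2 \<Longrightarrow> k \<in> {1..m choose 2} \<Longrightarrow>
        distr (P m) borel (U m k) = uniform_measure F (- A)"
    and V_distr: "\<And>m k. m \<ge> 2 \<Longrightarrow> k \<in> {1..m choose 2} \<Longrightarrow>
        distr (P m) borel (V m k) = uniform_measure F A"
    and indep: "\<And>m. m \<ge> 2 \<Longrightarrow> prob_space.indep_vars (P m) (\<lambda>_. borel)
        (\<lambda>i. case i of Inl j \<Rightarrow> (\<lambda>\<omega>. real (M m j \<omega>))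
                     | Inr (Inl k) \<Rightarrow> U m k
                     | Inr (Inr k) \<Rightarrow> V m k)
        (Inl ` {1..m} \<union> Inr ` Inl ` {1..m choose 2} \<union> Inr ` Inr ` {1..m choose 2})"
    and X_def: "\<And>m i j. m \<ge> 2 \<Longrightarrow> 1 \<le> i \<Longrightarrow> i < j \<Longrightarrow> j \<le> m \<Longrightarrow>
        X m (kidx m i j) = (\<lambda>\<omega>. if M m i \<omega> = M m j \<omega> then V m (kidx m i j) \<omega> else U m (kidx m i j) \<omega>)"
  shows "(\<forall>m\<ge>2. \<forall>k1\<in>{1..m choose 2}. \<forall>k2\<in>{1..m choose 2}. k1 \<noteq> k2 \<longrightarrow>
            prob_space.indep_var (P m) borel (X m k1) borel (X m k2))
       \<and> (let \<mu> = (\<integral>x. x \<partial>F);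
              \<sigma> = sqrt (\<integral>x. (x - \<mu>)\<^sup>2 \<partial>F);
              \<mu>U = (\<integral>x. x \<partial>(uniform_measure F (- A)));
              \<mu>V = (\<integral>x. x \<partial>(uniform_measure F A));
              r = sqrt ((1 / real l) * (1 - 1 / real l)) * (\<mu>V - \<mu>U) / \<sigma>
          in weak_conv_m
               (\<lambda>m. distr (P m) borel
                  (\<lambda>\<omega>. ((\<Sum>k = 1..m choose 2. X m k \<omega>) - \<mu> * real (m choose 2))
                        / (\<sigma> * sqrt (real (m choose 2)))))
               (limit_law l r))"
proof -
  interpret F: real_distribution F by (rule F)
  define FA FB where "FA = uniform_measure F A" and "FB = uniform_measure F (- A)"
  \<comment> \<open>Decodes a number into its pair; the two components serve as \<open>p\<close> and
    \<open>q\<close> of the locale.\<close>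
  define pr where "pr m = inv_into (index_pairs m) (\<lambda>(i, j). kidx m i j)" for m
  have pr_bij: "bij_betw (pr m) {1..m choose 2} (index_pairs m)" for m
    unfolding pr_def by (rule bij_betw_inv_into[OF bij_betw_kidx])
  have pr: "pr m k \<in> index_pairs m" "kidx m (fst (pr m k)) (snd (pr m k)) = k"
    if "k \<in> {1..m choose 2}" for m k
  proof -
    show "pr m k \<in> index_pairs m" using that pr_bij by (rule bij_betwE[rule_format, rotated])
    have "k \<in> (\<lambda>(i, j). kidx m i j) ` index_pairs m"
      using that bij_betw_imp_surj_on[OF bij_betw_kidx[of m]] by simp
    then have "(\<lambda>(i, j). kidx m i j) (pr m k) = k" unfolding pr_def by (rule f_inv_into_f)
    then show "kidx m (fst (pr m k)) (snd (pr m k)) = k" by (simp add: case_prod_beta')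
  qed
  have pr_bounds: "1 \<le> fst (pr m k)" "fst (pr m k) < snd (pr m k)" "snd (pr m k) \<le> m"
    if "k \<in> {1..m choose 2}" for m k
    using pr(1)[OF that] by (auto simp: case_prod_beta')
  have mix: "categorical_mixture (P m) {1..m} {1..m choose 2} {0..<l} (M m) (U m) (V m) (X m)
      (\<lambda>k. fst (pr m k)) (\<lambda>k. snd (pr m k)) FB FA" if m: "m \<ge> 2" for m
  proof (intro categorical_mixture.intro categorical_mixture_axioms.intro P m indep)
    fix k assume k: "k \<in> {1..m choose 2}"
    show "fst (pr m k) \<in> {1..m}" "snd (pr m k) \<in> {1..m}" using pr_bounds[OF k] by auto
    show "X m k = (\<lambda>\<omega>. if M m (fst (pr m k)) \<omega> = M m (snd (pr m k)) \<omega> then V m k \<omega> else U m k \<omega>)"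
      using X_def[OF m pr_bounds[OF k]] by (simp only: pr(2)[OF k])
    show "U m k \<in> borel_measurable (P m)" "V m k \<in> borel_measurable (P m)"
      by (rule U_meas[OF m k], rule V_meas[OF m k])
    show "distr (P m) borel (U m k) = FB" "distr (P m) borel (V m k) = FA"
      unfolding FA_def FB_def by (rule U_distr[OF m k], rule V_distr[OF m k])
  next
    fix j assume j: "j \<in> {1..m}"
    show "M m j \<in> measurable (P m) (count_space UNIV)" by (rule M_meas[OF m j])
    show "distr (P m) (count_space UNIV) (M m j) = measure_pmf (pmf_of_set {0..<l})" by (rule M_distr[OF m j])
  qed (use l in simp_all)

  \<comment> \<open>Pairwise independence of the constructed variables\<close>
  have pairwise: "\<forall>m\<ge>2. \<forall>k1\<in>{1..m choose 2}. \<forall>k2\<in>{1..m choose 2}. k1 \<noteq> k2 \<longrightarrow>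
      prob_space.indep_var (P m) borel (X m k1) borel (X m k2)"
  proof (intro allI ballI impI)
    fix m k1 k2 :: nat
    assume m: "2 \<le> m" and k1: "k1 \<in> {1..m choose 2}" and k2: "k2 \<in> {1..m choose 2}" and "k1 \<noteq> k2"
    then have "pr m k1 \<noteq> pr m k2"
      using inj_onD[OF bij_betw_imp_inj_on[OF pr_bij[of m]]] by blast
    \<comment> \<open>Components are in increasing order, so different pairs also differ as
      two-element sets.\<close>
    then have "{fst (pr m k1), snd (pr m k1)} \<noteq> {fst (pr m k2), snd (pr m k2)}"
      using pr_bounds(2)[OF k1] pr_bounds(2)[OF k2] by (auto simp: doubleton_eq_iff prod_eq_iff)
    with pr_bounds(2)[OF k1] pr_bounds(2)[OF k2]
    show "prob_space.indep_var (P m) borel (X m k1) borel (X m k2)"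
      by (intro categorical_mixture.indep_var_mixture[OF mix[OF m]] k1 k2) auto
  qed

  \<comment> \<open>Constants of the limit and the decomposition of the variance\<close>
  define \<mu> where "\<mu> = (\<integral>x. x \<partial>F)"
  define \<sigma> where "\<sigma> = sqrt (\<integral>x. (x - \<mu>)\<^sup>2 \<partial>F)"
  define \<mu>U where "\<mu>U = (\<integral>x. x \<partial>FB)"
  define \<mu>V where "\<mu>V = (\<integral>x. x \<partial>FA)"
  define r where "r = sqrt ((1 / real l) * (1 - 1 / real l)) * (\<mu>V - \<mu>U) / \<sigma>"
  define vU where "vU = (\<integral>x. (x - \<mu>U)\<^sup>2 \<partial>FB)"
  define vV where "vV = (\<integral>x. (x - \<mu>V)\<^sup>2 \<partial>FA)"
  define S where "S m \<omega> = ((\<Sum>k = 1..m choose 2. X m k \<omega>) - \<mu> * real (m choose 2))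
      / (\<sigma> * sqrt (real (m choose 2)))" for m \<omega>
  have l0: "0 < 1 / real l" "1 / real l < 1" using l by auto
  have PB: "measure F (- A) = 1 - 1 / real l"
    using A PA F.prob_compl[of A] by (simp add: Compl_eq_Diff_UNIV)
  have A01: "A \<in> sets borel" "measure F A > 0" "measure F A < 1" "- A \<in> sets borel" "measure F (- A) > 0"
    using A PA PB l0 by auto
  interpret FA: real_distribution FA
    unfolding FA_def by (rule F.real_distribution_uniform_measure[OF A01(1,2)])
  interpret FB: real_distribution FB
    unfolding FB_def by (rule F.real_distribution_uniform_measure[OF A01(4,5)])
  have FA2: "integrable FA (\<lambda>x. x\<^sup>2)"
    unfolding FA_def by (rule F.integrable_uniform_measure[OF _ _ var_fin]) (use A01 in auto)
  have FB2: "integrable FB (\<lambda>x. x\<^sup>2)"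
    unfolding FB_def by (rule F.integrable_uniform_measure[OF _ _ var_fin]) (use A01 in auto)
  have mean: "\<mu> = 1 / real l * \<mu>V + (1 - 1 / real l) * \<mu>U"
    using F.variance_split(1)[OF A01(1-3) var_fin] by (simp only: PA \<mu>_def \<mu>U_def \<mu>V_def FA_def FB_def)
  define q where "q = 1 / real l * (1 - 1 / real l)"
  have q: "q > 0" using l0 by (simp add: q_def)
  define d where "d = \<mu>V - \<mu>U"
  have d: "d \<noteq> 0" using cond_means by (simp add: d_def \<mu>U_def \<mu>V_def FA_def FB_def)
  have var: "(\<integral>x. (x - \<mu>)\<^sup>2 \<partial>F) = 1 / real l * vV + (1 - 1 / real l) * vU + q * d\<^sup>2"
    using F.variance_split(2)[OF A01(1-3) var_fin]
    by (simp only: PA \<mu>_def \<mu>U_def \<mu>V_def vU_def vV_def FA_def FB_def q_def d_def mult.assoc)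
  have v0: "vU \<ge> 0" "vV \<ge> 0" unfolding vU_def vV_def by simp_all
  have \<sigma>2: "\<sigma>\<^sup>2 = 1 / real l * vV + (1 - 1 / real l) * vU + q * d\<^sup>2"
    unfolding \<sigma>_def by (subst real_sqrt_pow2) (simp_all only: var[symmetric], simp)
  have within: "1 / real l * vV + (1 - 1 / real l) * vU \<ge> 0"
    using v0 l0 by (intro add_nonneg_nonneg mult_nonneg_nonneg) auto
  \<comment> \<open>Distinct conditional means make the variance between the cells positive, so
    dividing by \<open>\<sigma>\<close> is meaningful.\<close>
  have "q * d\<^sup>2 > 0" using q d by simp
  with within have \<sigma>2_pos: "\<sigma>\<^sup>2 > 0" unfolding \<sigma>2 by linarith
  moreover have "\<sigma> \<ge> 0" unfolding \<sigma>_def by simp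
  ultimately have \<sigma>: "\<sigma> > 0" by (cases "\<sigma> = 0") auto
  \<comment> \<open>\<open>r\<^sup>2\<close> is the share of the variance that lies between the two
    cells, hence at most 1.\<close>
  have r2: "r\<^sup>2 = q * d\<^sup>2 / \<sigma>\<^sup>2"
    using q by (simp add: r_def q_def d_def power_mult_distrib power_divide)
  have r1: "r\<^sup>2 \<le> 1"
    unfolding r2 using \<sigma>2_pos within by (simp add: divide_le_eq \<sigma>2)

  \<comment> \<open>The exact characteristic function of the standardised sum for fixed
    \<open>m\<close>\<close>
  have matches: "card {k \<in> {1..m choose 2}. h (fst (pr m k)) = h (snd (pr m k))} = matches m h"
    for m and h :: "nat \<Rightarrow> nat"
  proof -
    let ?K = "{k \<in> {1..m choose 2}. h (fst (pr m k)) = h (snd (pr m k))}"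
    have "pr m ` ?K = {x \<in> pr m ` {1..m choose 2}. h (fst x) = h (snd x)}" by blast
    also have "\<dots> = {(i, j) \<in> index_pairs m. h i = h j}"
      using bij_betw_imp_surj_on[OF pr_bij[of m]] by auto
    finally have image: "pr m ` ?K = {(i, j) \<in> index_pairs m. h i = h j}" .
    have "inj_on (pr m) ?K"
      by (rule inj_on_subset[OF bij_betw_imp_inj_on[OF pr_bij[of m]]]) auto
    then show ?thesis
      unfolding matches_def image[symmetric] by (rule card_image[symmetric])
  qed

  have char_S: "char (distr (P m) borel (S m)) t =
      (\<integral>h. (\<integral>x. iexp (t / \<sigma> / sqrt (real (m choose 2)) * (x - \<mu>U)) \<partial>FB) ^ ((m choose 2) - matches m h) *
        (\<integral>x. iexp (t / \<sigma> / sqrt (real (m choose 2)) * (x - \<mu>V)) \<partial>FA) ^ matches m h *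
        iexp (t / \<sigma> * d * (real (matches m h) - real (m choose 2) / real (card {0..<l})) / sqrt (real (m choose 2)))
      \<partial>measure_pmf (pmf_of_set ({1..m} \<rightarrow>\<^sub>E {0..<l})))"
    if m: "m \<ge> 2" for m t
  proof -
    interpret mix: categorical_mixture "P m" "{1..m}" "{1..m choose 2}" "{0..<l}" "M m" "U m" "V m" "X m"
      "\<lambda>k. fst (pr m k)" "\<lambda>k. snd (pr m k)" FB FA by (rule mix[OF m])
    define n where "n = m choose 2"
    define c where "c = t / \<sigma> / sqrt (real n)"
    define g where "g x = iexp (c * (x - \<mu>))" for x
    have X_meas: "X m k \<in> borel_measurable (P m)" if "k \<in> {1..n}" for k
      using that unfolding n_def by (rule mix.X_measurable)
    have S_meas: "S m \<in> borel_measurable (P m)"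
      unfolding S_def[abs_def] n_def[symmetric]
      by (intro borel_measurable_divide borel_measurable_diff borel_measurable_sum X_meas) auto
    have tS: "t * S m \<omega> = (\<Sum>k\<in>{1..n}. c * (X m k \<omega> - \<mu>))" for \<omega>
    proof -
      have "(\<Sum>k\<in>{1..n}. c * (X m k \<omega> - \<mu>)) = c * ((\<Sum>k\<in>{1..n}. X m k \<omega>) - \<mu> * real n)"
        by (simp add: sum_distrib_left[symmetric] sum_subtractf)
      then show ?thesis by (simp add: S_def c_def n_def[symmetric])
    qed
    have "char (distr (P m) borel (S m)) t = (\<integral>\<omega>. iexp (t * S m \<omega>) \<partial>P m)"
      unfolding char_def by (rule integral_distr[OF S_meas]) simp
    also have "\<dots> = (\<integral>\<omega>. (\<Prod>k\<in>{1..n}. g (X m k \<omega>)) \<partial>P m)"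
      unfolding tS g_def by (simp only: of_real_sum sum_distrib_left exp_sum[OF finite_atLeastAtMost])
    also have "\<dots> = (\<integral>h. (\<integral>x. g x \<partial>FB) ^ (n - matches m h) * (\<integral>x. g x \<partial>FA) ^ matches m h
        \<partial>measure_pmf (pmf_of_set ({1..m} \<rightarrow>\<^sub>E {0..<l})))"
    proof -
      have "g \<in> borel_measurable borel" "norm (g x) \<le> 1" for x by (simp_all add: g_def[abs_def])
      from mix.expectation_prod_mixture_const[OF this]
      show ?thesis unfolding matches card_atLeastAtMost n_def by (simp only: diff_Suc_1)
    qed
    also have "\<dots> = (\<integral>h. (\<integral>x. iexp (c * (x - \<mu>U)) \<partial>FB) ^ (n - matches m h) *
        (\<integral>x. iexp (c * (x - \<mu>V)) \<partial>FA) ^ matches m h *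
        iexp (t / \<sigma> * d * (real (matches m h) - real n / real (card {0..<l})) / sqrt (real n))
        \<partial>measure_pmf (pmf_of_set ({1..m} \<rightarrow>\<^sub>E {0..<l})))"
    proof (rule Bochner_Integration.integral_cong)
      fix h :: "nat \<Rightarrow> nat"
      \<comment> \<open>Recentring from \<open>\<mu>\<close> to the mean of the cell; the phases
        split off here collect the conditional mean of the sum given the labels.\<close>
      have g_split: "g x = iexp (c * (a - \<mu>)) * iexp (c * (x - a))" for x a
        by (simp add: g_def exp_add[symmetric] algebra_simps)
      have gB: "(\<integral>x. g x \<partial>FB) = iexp (c * (\<mu>U - \<mu>)) * (\<integral>x. iexp (c * (x - \<mu>U)) \<partial>FB)"
        unfolding g_split[of _ \<mu>U] by (rule integral_mult_right_zero)
      have gA: "(\<integral>x. g x \<partial>FA) = iexp (c * (\<mu>V - \<mu>)) * (\<integral>x. iexp (c * (x - \<mu>V)) \<partial>FA)"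
        unfolding g_split[of _ \<mu>V] by (rule integral_mult_right_zero)
      have le: "matches m h \<le> n" unfolding n_def by (rule matches_le)
      have "iexp (c * (\<mu>U - \<mu>)) ^ (n - matches m h) * iexp (c * (\<mu>V - \<mu>)) ^ matches m h =
          iexp (real (n - matches m h) * (c * (\<mu>U - \<mu>)) + real (matches m h) * (c * (\<mu>V - \<mu>)))"
        by (simp add: exp_of_nat_mult[symmetric] exp_add[symmetric] algebra_simps)
      \<comment> \<open>By \<open>mean\<close>, \<open>\<mu>U - \<mu> = - d / l\<close> and
        \<open>\<mu>V - \<mu> = (1 - 1 / l) * d\<close>, so the total shift is a multiple of
        \<open>matches m h - n / l\<close>.\<close>
      also have "real (n - matches m h) * (c * (\<mu>U - \<mu>)) + real (matches m h) * (c * (\<mu>V - \<mu>)) =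
          c * d * (real (matches m h) - real n / real (card {0..<l}))"
        unfolding mean using le l by (simp add: of_nat_diff d_def field_simps)
      also have "\<dots> = t / \<sigma> * d * (real (matches m h) - real n / real (card {0..<l})) / sqrt (real n)"
        by (simp add: c_def)
      finally have e: "iexp (c * (\<mu>U - \<mu>)) ^ (n - matches m h) * iexp (c * (\<mu>V - \<mu>)) ^ matches m h =
          iexp (t / \<sigma> * d * (real (matches m h) - real n / real (card {0..<l})) / sqrt (real n))" .
      show "(\<integral>x. g x \<partial>FB) ^ (n - matches m h) * (\<integral>x. g x \<partial>FA) ^ matches m h =
          (\<integral>x. iexp (c * (x - \<mu>U)) \<partial>FB) ^ (n - matches m h) *
        (\<integral>x. iexp (c * (x - \<mu>V)) \<partial>FA) ^ matches m h *
        iexp (t / \<sigma> * d * (real (matches m h) - real n / real (card {0..<l})) / sqrt (real n))"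
        unfolding gA gB power_mult_distrib e[symmetric] by (simp only: mult_ac)
    qed simp
    finally show ?thesis by (simp only: c_def n_def)
  qed

  \<comment> \<open>\<open>P m\<close> is unspecified for \<open>m < 2\<close>, but the continuity theorem wants distributions throughout.\<close>
  define D where "D m = (if m \<ge> 2 then distr (P m) borel (S m) else limit_law l r)" for m
  have limit: "real_distribution (limit_law l r)" by (rule real_distribution_limit_law[OF l r1])

  \<comment> \<open>Passage to the limit and identification of the constants\<close>
  have "weak_conv_m D (limit_law l r)"
  proof (rule levy_continuity)
    show "real_distribution (D m)" for m
    proof (cases "m \<ge> 2")
      case True
      interpret mix: categorical_mixture "P m" "{1..m}" "{1..m choose 2}" "{0..<l}" "M m" "U m" "V m" "X m"
        "\<lambda>k. fst (pr m k)" "\<lambda>k. snd (pr m k)" FB FA by (rule mix[OF True])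
      have "S m \<in> borel_measurable (P m)"
        unfolding S_def[abs_def]
        by (intro borel_measurable_divide borel_measurable_diff borel_measurable_sum mix.X_measurable) auto
      then have "real_distribution (distr (P m) borel (S m))" by (rule mix.real_distribution_distr)
      then show ?thesis using True by (simp only: D_def if_True)
    next
      case False
      then show ?thesis using limit by (simp only: D_def if_False)
    qed
    show "(\<lambda>m. char (D m) t) \<longlonglongrightarrow> char (limit_law l r) t" for t
    proof -
      define s where "s = t / \<sigma>"
      define \<alpha> where "\<alpha> n = (\<integral>x. iexp (s / sqrt (real n) * (x - \<mu>U)) \<partial>FB)" for n
      define \<beta> where "\<beta> n = (\<integral>x. iexp (s / sqrt (real n) * (x - \<mu>V)) \<partial>FA)" for n
      have \<alpha>: "norm (\<alpha> n) \<le> 1"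
        "(\<lambda>n. real n * norm (\<alpha> n - of_real (exp (- (s\<^sup>2 * vU / 2) / real n)))) \<longlonglongrightarrow> 0" for n
        using FB.centred_char_approx[OF FB2] by (simp_all only: \<alpha>_def \<mu>U_def[symmetric] vU_def)
      have \<beta>: "norm (\<beta> n) \<le> 1"
        "(\<lambda>n. real n * norm (\<beta> n - of_real (exp (- (s\<^sup>2 * vV / 2) / real n)))) \<longlonglongrightarrow> 0" for n
        using FA.centred_char_approx[OF FA2] by (simp_all only: \<beta>_def \<mu>V_def[symmetric] vV_def)
      let ?\<kappa> = "s * d / (sqrt 2 * real (card {0..<l}))"
      have lim: "(\<lambda>m. \<integral>h. \<alpha> (m choose 2) ^ ((m choose 2) - matches m h) * \<beta> (m choose 2) ^ matches m h *
          iexp (s * d * (real (matches m h) - real (m choose 2) / real (card {0..<l})) / sqrt (real (m choose 2)))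
          \<partial>measure_pmf (pmf_of_set ({1..m} \<rightarrow>\<^sub>E {0..<l})))
        \<longlonglongrightarrow> of_real (exp (- ((1 - 1 / real (card {0..<l})) * (s\<^sup>2 * vU / 2) + 1 / real (card {0..<l}) * (s\<^sup>2 * vV / 2)))) *
          (iexp (- ?\<kappa> * (real (card {0..<l}) - 1)) * char (chi2_distribution (card {0..<l} - 1)) ?\<kappa>)"
        using l v0 by (intro mixture_char_tendsto \<alpha> \<beta>) auto
      \<comment> \<open>Removing the part \<open>q * d\<^sup>2\<close> between the cells from
        \<open>\<sigma>\<^sup>2\<close> leaves the weighted average of \<open>vU\<close> and
        \<open>vV\<close>; dividing by \<open>\<sigma>\<^sup>2\<close> turns it into
        \<open>1 - r\<^sup>2\<close>.\<close>
      have "(1 - 1 / real (card {0..<l})) * (s\<^sup>2 * vU / 2) + 1 / real (card {0..<l}) * (s\<^sup>2 * vV / 2) =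
          s\<^sup>2 * (\<sigma>\<^sup>2 - q * d\<^sup>2) / 2"
        unfolding \<sigma>2 using l by (simp add: field_simps)
      also have "\<dots> = t\<^sup>2 * (1 - r\<^sup>2) / 2"
        unfolding r2 s_def using \<sigma> by (simp add: power_divide field_simps)
      finally have w: "(1 - 1 / real (card {0..<l})) * (s\<^sup>2 * vU / 2) + 1 / real (card {0..<l}) * (s\<^sup>2 * vV / 2) =
          t\<^sup>2 * (1 - r\<^sup>2) / 2" .
      have sq: "sqrt ((1 / real l) * (1 - 1 / real l)) = sqrt (real (l - 1)) / real l"
      proof -
        have "(1 / real l) * (1 - 1 / real l) = real (l - 1) / (real l)\<^sup>2"
          using l by (simp add: of_nat_diff power2_eq_square field_simps)
        then show ?thesis by (simp add: real_sqrt_divide)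
      qed
      \<comment> \<open>The factor \<open>sqrt (l - 1) / l\<close> inside \<open>r\<close> cancels
        against the standard deviation \<open>sqrt (2 * (l - 1))\<close> of the chi-squared law,
        leaving \<open>1 / (sqrt 2 * l)\<close>.\<close>
      have \<kappa>: "?\<kappa> = t * r / sqrt (2 * real (l - 1))"
      proof -
        have "x / (sqrt 2 * real l) = y * (sqrt (real (l - 1)) / real l) / sqrt (2 * real (l - 1))"
          if "x = y" for x y :: real
        proof -
          have "sqrt (real (l - 1)) \<noteq> 0" using l by simp
          then show ?thesis using that unfolding real_sqrt_mult by (simp add: field_simps)
        qed
        from this[of "s * d" "t * d / \<sigma>"] show ?thesis
          unfolding r_def sq by (simp add: s_def d_def mult_ac)
      qed
      have l1: "real (card {0..<l}) - 1 = real (l - 1)" using l by simp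
      have "char (limit_law l r) t = of_real (exp (- ((1 - 1 / real (card {0..<l})) * (s\<^sup>2 * vU / 2) + 1 / real (card {0..<l}) * (s\<^sup>2 * vV / 2)))) *
          (iexp (- ?\<kappa> * (real (card {0..<l}) - 1)) * char (chi2_distribution (card {0..<l} - 1)) ?\<kappa>)"
        unfolding w l1 \<kappa> char_limit_law[OF l r1] by simp
      note lim = lim[folded this]
      have "\<forall>\<^sub>F m in sequentially. (\<integral>h. \<alpha> (m choose 2) ^ ((m choose 2) - matches m h) * \<beta> (m choose 2) ^ matches m h *
          iexp (s * d * (real (matches m h) - real (m choose 2) / real (card {0..<l})) / sqrt (real (m choose 2)))
          \<partial>measure_pmf (pmf_of_set ({1..m} \<rightarrow>\<^sub>E {0..<l}))) = char (D m) t"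
      proof (rule eventually_sequentiallyI)
        fix m :: nat assume m: "2 \<le> m"
        then have "D m = distr (P m) borel (S m)" by (simp add: D_def)
        then show "(\<integral>h. \<alpha> (m choose 2) ^ ((m choose 2) - matches m h) * \<beta> (m choose 2) ^ matches m h *
          iexp (s * d * (real (matches m h) - real (m choose 2) / real (card {0..<l})) / sqrt (real (m choose 2)))
          \<partial>measure_pmf (pmf_of_set ({1..m} \<rightarrow>\<^sub>E {0..<l}))) = char (D m) t"
          by (simp only: char_S[OF m] \<alpha>_def \<beta>_def s_def)
      qed
      then show ?thesis by (rule Lim_transform_eventually[OF lim])
    qed
  qed (rule limit)
  \<comment> \<open>\<open>D\<close> may differ from the laws of \<open>S m\<close> only for
    \<open>m < 2\<close>, which the pointwise limits of the distribution functions ignore.\<close>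
  then have weak: "weak_conv_m (\<lambda>m. distr (P m) borel (S m)) (limit_law l r)"
    unfolding weak_conv_m_def weak_conv_def
  proof (intro allI impI)
    fix x
    assume *: "\<forall>x. isCont (cdf (limit_law l r)) x \<longrightarrow> (\<lambda>n. cdf (D n) x) \<longlonglongrightarrow> cdf (limit_law l r) x"
      and "isCont (cdf (limit_law l r)) x"
    then have "(\<lambda>n. cdf (D n) x) \<longlonglongrightarrow> cdf (limit_law l r) x" by blast
    then show "(\<lambda>n. cdf (distr (P n) borel (S n)) x) \<longlonglongrightarrow> cdf (limit_law l r) x"
    proof (rule Lim_transform_eventually)
      show "\<forall>\<^sub>F n in sequentially. cdf (D n) x = cdf (distr (P n) borel (S n)) x"
        by (rule eventually_sequentiallyI[of 2]) (simp add: D_def)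
    qed
  qed
  show ?thesis
    unfolding Let_def using pairwise weak
    unfolding S_def[abs_def] r_def \<sigma>_def \<mu>_def \<mu>U_def \<mu>V_def FA_def FB_def by blast
qed

end
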